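(* Let $E \subset F$ be a finite Galois extension of fields with Galois group $G$, and let $H$ be an additive subgroup of $F$ that spans $F$ as an $E$-vector space. Then there exists $\alpha \in H$ such that $(\sigma \alpha)_{\sigma \in G}$ is a vector space basis of $F$ over $E$.
   Context: An additive subgroup of $F$ is a subgroup of the additive group of $F$; it is not required to be an $E$-subspace. *)

theory Defs
  imports Complex_Main
begin

text \<open>
  A field extension F of E is given by two field types and a ring homomorphism
  \<open>\<iota> :: 'e \<Rightarrow> 'f\<close>, which is automatically injective; the subfield E of F is
  \<open>range \<iota>\<close>. The type of scalars is \<open>'e\<close>, so that linear algebra over E is that of the
  locales \<open>module\<close> and \<open>vector_space\<close>.
\<close>

definition field_embedding :: "('e::field \<Rightarrow> 'f::field) \<Rightarrow> bool" where
  "field_embedding \<iota> \<longleftrightarrow>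
     \<iota> 1 = 1 \<and> (\<forall>x y. \<iota> (x + y) = \<iota> x + \<iota> y) \<and> (\<forall>x y. \<iota> (x * y) = \<iota> x * \<iota> y)"

definition ext_scale :: "('e::field \<Rightarrow> 'f::field) \<Rightarrow> 'e \<Rightarrow> 'f \<Rightarrow> 'f" where
  "ext_scale \<iota> c x = \<iota> c * x"

abbreviation ext_span :: "('e::field \<Rightarrow> 'f::field) \<Rightarrow> 'f set \<Rightarrow> 'f set" where
  "ext_span \<iota> \<equiv> module.span (ext_scale \<iota>)"

lemma vector_space_ext_scale:
  assumes "field_embedding \<iota>"
  shows "vector_space (ext_scale \<iota>)"
  using assms by unfold_locales (auto simp: field_embedding_def ext_scale_def algebra_simps)

lemma field_embedding_inj:
  assumes "field_embedding \<iota>"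
  shows "inj \<iota>"
proof (rule injI, rule ccontr)
  fix x y assume eq: "\<iota> x = \<iota> y" and ne: "x \<noteq> y"
  have add: "\<And>a b. \<iota> (a + b) = \<iota> a + \<iota> b" and mult: "\<And>a b. \<iota> (a * b) = \<iota> a * \<iota> b"
    and one: "\<iota> 1 = 1" using assms by (auto simp: field_embedding_def)
  have "\<iota> (x - y) = 0" using add[of "x - y" y] eq by simp
  hence "\<iota> ((x - y) * inverse (x - y)) = 0" by (simp add: mult)
  thus False using ne one by simp
qed

definition galois_group :: "('e::field \<Rightarrow> 'f::field) \<Rightarrow> ('f \<Rightarrow> 'f) set" where
  "galois_group \<iota> = {\<sigma>. bij \<sigma> \<and> (\<forall>x y. \<sigma> (x + y) = \<sigma> x + \<sigma> y) \<and>
     (\<forall>x y. \<sigma> (x * y) = \<sigma> x * \<sigma> y) \<and> (\<forall>c. \<sigma> (\<iota> c) = \<iota> c)}"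

definition finite_extension :: "('e::field \<Rightarrow> 'f::field) \<Rightarrow> bool" where
  "finite_extension \<iota> \<longleftrightarrow> field_embedding \<iota> \<and>
     (\<exists>B. finite B \<and> ext_span \<iota> B = UNIV)"

text \<open>
  Galois in the sense of Artin: the elements of F fixed by all automorphisms of F over E are
  exactly those of E.
\<close>

definition finite_galois_extension :: "('e::field \<Rightarrow> 'f::field) \<Rightarrow> bool" where
  "finite_galois_extension \<iota> \<longleftrightarrow> finite_extension \<iota> \<and>
     {x. \<forall>\<sigma>\<in>galois_group \<iota>. \<sigma> x = x} = range \<iota>"

definition is_additive_subgroup :: "'f::ab_group_add set \<Rightarrow> bool" where
  "is_additive_subgroup H \<longleftrightarrow> 0 \<in> H \<and> (\<forall>x\<in>H. \<forall>y\<in>H. x + y \<in> H) \<and> (\<forall>x\<in>H. - x \<in> H)"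

text \<open>
  Bases are indexed families, so repeated members are excluded by injectivity:
  \<open>module.dependent\<close> only sees the underlying set.
\<close>

definition is_basis_family ::
  "('e::field \<Rightarrow> 'f::field) \<Rightarrow> 'i set \<Rightarrow> ('i \<Rightarrow> 'f) \<Rightarrow> bool" where
  "is_basis_family \<iota> I b \<longleftrightarrow> inj_on b I \<and> \<not> module.dependent (ext_scale \<iota>) (b ` I) \<and>
     ext_span \<iota> (b ` I) = UNIV"

end

theory Submission
  imports
    Defs
    "HOL-Library.FuncSet"
    "HOL-Library.Function_Algebras"
    "HOL-Algebra.Algebraic_Closure_Type"
    "Jordan_Normal_Form.Determinant"
begin

text \<open>
  Let \<open>K\<close> be an algebraic closure of \<open>F\<close>. An element \<open>\<alpha>\<close> generates a normal basis iff
  \<open>\<phi> \<alpha> = (\<sigma> \<alpha>)\<^bsub>\<sigma>\<^esub>\<close> is a unit of the group algebra \<open>K[G]\<close>, and by Dedekind independence the additive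
  group \<open>\<phi> H\<close> spans \<open>K[G]\<close> over \<open>K\<close>. It therefore suffices that an additive subgroup spanning a
  finite-dimensional \<open>K\<close>-algebra contains a unit. Let \<open>\<rho>\<^sub>1, \<dots>, \<rho>\<^sub>r\<close> be the distinct irreducible
  representations. An element is a unit iff \<open>f = \<Prod> det \<rho>\<^sub>i\<close> does not vanish on it. By the density
  theorem the algebra maps onto the product of the matrix algebras, so it has elements \<open>v\<^sub>1, \<dots>, v\<^sub>d\<close>
  mapping to the diagonal matrix units, with \<open>d = deg f\<close>. As \<open>f\<close> is nonzero on their sum and zero on
  every proper partial sum, the full polarization of \<open>f\<close> does not vanish at \<open>(v\<^sub>1, \<dots>, v\<^sub>d)\<close>. Being
  multilinear, it cannot vanish identically on the spanning group either; but it is an alternating sum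
  of values of \<open>f\<close> on that group.
\<close>

section \<open>Polarization\<close>

text \<open>Ryser's formula for the permanent. When the products are expanded over maps
  \<open>g\<close>, the coefficient of \<open>g\<close> is an alternating count of the sets between
  its image and \<open>I\<close>; it is 1 for surjective \<open>g\<close> and 0 otherwise.\<close>

lemma ryser:
  fixes x :: "'i \<Rightarrow> 'i \<Rightarrow> 'k::comm_ring_1"
  assumes I: "finite I"
  shows "(\<Sum>S\<in>Pow I. (-1) ^ card (I - S) * (\<Prod>i\<in>I. \<Sum>k\<in>S. x i k)) =
    (\<Sum>g | g \<in> I \<rightarrow>\<^sub>E I \<and> g ` I = I. \<Prod>i\<in>I. x i (g i))"
proof -
  have sgn: "(\<Sum>S\<in>Pow I. (-1) ^ card (I - S) * (if g ` I \<subseteq> S then 1 else 0)) =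
      (if g ` I = I then 1 else 0 :: 'k)" if "g ` I \<subseteq> I" for g
  proof -
    \<comment> \<open>The factor at \<open>i\<close> is 1 or 0 according as \<open>g\<close> hits
      \<open>i\<close> or not; multiplying out gives the alternating sum over
      \<open>S\<close>.\<close>
    have "(\<Prod>i\<in>I. (1::'k) - (if i \<in> g ` I then 0 else 1)) =
        (\<Sum>S\<in>Pow I. (-1) ^ card (I - S) * (\<Prod>i\<in>S. 1) * (\<Prod>i\<in>I-S. if i \<in> g ` I then 0 else 1))"
      using I by (subst prod_diff_conv_sum')
        (auto intro!: sum.cong simp: card_Diff_subset[OF finite_subset[OF _ I]])
    also have "\<dots> = (\<Sum>S\<in>Pow I. (-1) ^ card (I - S) * (if g ` I \<subseteq> S then 1 else 0))"
    proof (rule sum.cong[OF refl])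
      fix S assume "S \<in> Pow I"
      then have fin: "finite (I - S)" using I by auto
      have "(\<Prod>i\<in>I-S. if i \<in> g ` I then 0 else (1::'k)) = (if g ` I \<subseteq> S then 1 else 0)"
      proof (cases "g ` I \<subseteq> S")
        case True
        then show ?thesis by (auto intro!: prod.neutral)
      next
        case False
        then obtain i where "i \<in> g ` I" "i \<notin> S" by auto
        then have "\<exists>i\<in>I - S. (if i \<in> g ` I then 0 else (1::'k)) = 0" using that by (intro bexI[of _ i]) auto
        from prod_zero[OF fin this] show ?thesis using False by (simp only: if_False)
      qed
      then show "(-1) ^ card (I - S) * (\<Prod>i\<in>S. 1) * (\<Prod>i\<in>I-S. if i \<in> g ` I then 0 else (1::'k)) =
          (-1) ^ card (I - S) * (if g ` I \<subseteq> S then 1 else 0)" by simp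
    qed
    finally have *: "(\<Sum>S\<in>Pow I. (-1) ^ card (I - S) * (if g ` I \<subseteq> S then 1 else 0)) =
      (\<Prod>i\<in>I. (1::'k) - (if i \<in> g ` I then 0 else 1))" ..
    show ?thesis
    proof (cases "g ` I = I")
      case True
      then show ?thesis unfolding * by (auto intro!: prod.neutral)
    next
      case False
      then have "\<not> I \<subseteq> g ` I" using that by auto
      then obtain i where "i \<in> I" "i \<notin> g ` I" by (meson subsetI)
      then have "\<exists>i\<in>I. (1::'k) - (if i \<in> g ` I then 0 else 1) = 0" by (intro bexI[of _ i]) simp_all
      from prod_zero[OF I this] show ?thesis unfolding * using False by (simp only: if_False)
    qed
  qed
  have "(\<Sum>S\<in>Pow I. (-1) ^ card (I - S) * (\<Prod>i\<in>I. \<Sum>k\<in>S. x i k)) =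
     (\<Sum>S\<in>Pow I. \<Sum>g\<in>I \<rightarrow>\<^sub>E I. (-1) ^ card (I - S) * (if g ` I \<subseteq> S then 1 else 0) * (\<Prod>i\<in>I. x i (g i)))"
  proof (rule sum.cong[OF refl])
    fix S assume S: "S \<in> Pow I"
    have "(\<Prod>i\<in>I. \<Sum>k\<in>S. x i k) = (\<Sum>g\<in>I \<rightarrow>\<^sub>E S. \<Prod>i\<in>I. x i (g i))"
      using S I by (intro prod_sum_PiE) (auto intro: finite_subset)
    also have "\<dots> = (\<Sum>g\<in>I \<rightarrow>\<^sub>E I. (if g ` I \<subseteq> S then 1 else 0) * (\<Prod>i\<in>I. x i (g i)))"
      using S I by (intro sum.mono_neutral_cong_left finite_PiE) (auto simp: PiE_def Pi_def image_subset_iff)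
    finally show "(-1) ^ card (I - S) * (\<Prod>i\<in>I. \<Sum>k\<in>S. x i k) = 
        (\<Sum>g\<in>I \<rightarrow>\<^sub>E I. (-1) ^ card (I - S) * (if g ` I \<subseteq> S then 1 else 0) * (\<Prod>i\<in>I. x i (g i)))"
      by (simp add: sum_distrib_left mult.assoc)
  qed
  also have "\<dots> = (\<Sum>g\<in>I \<rightarrow>\<^sub>E I. (if g ` I = I then 1 else 0) * (\<Prod>i\<in>I. x i (g i)))"
    by (subst sum.swap, intro sum.cong[OF refl], subst sum_distrib_right[symmetric], subst sgn) auto
  also have "\<dots> = (\<Sum>g | g \<in> I \<rightarrow>\<^sub>E I \<and> g ` I = I. \<Prod>i\<in>I. x i (g i))"
    using I by (intro sum.mono_neutral_cong_right finite_PiE) auto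
  finally show ?thesis .
qed

text \<open>
  Nonvanishing of \<open>f\<close> on a merely additive set cannot be read off from \<open>f\<close> being a nonzero
  polynomial (\<open>t\<^sup>p - t\<close> vanishes on the prime field). Full polarization turns \<open>f\<close> into a
  multilinear form, which is determined by its values on a spanning set.
\<close>

lemma polarization_nonzero:
  fixes L :: "'j \<Rightarrow> 'i \<Rightarrow> 'a::ab_group_add \<Rightarrow> 'k::field" and s :: "'j \<Rightarrow> 'k"
  assumes I: "finite I"
    and f: "\<And>x. f x = (\<Sum>j\<in>J. s j * (\<Prod>i\<in>I. L j i x))"
    and lin: "\<And>j i. j \<in> J \<Longrightarrow> i \<in> I \<Longrightarrow> Vector_Spaces.linear sc (*) (L j i)"
    and dense: "\<And>l x. Vector_Spaces.linear sc (*) l \<Longrightarrow> (\<And>y. y \<in> \<Phi> \<Longrightarrow> l y = 0) \<Longrightarrow> x \<in> A \<Longrightarrow> l x = (0::'k)"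
    and sc: "vector_space sc"
    and zero: "0 \<in> \<Phi>" and add: "\<And>x y. x \<in> \<Phi> \<Longrightarrow> y \<in> \<Phi> \<Longrightarrow> x + y \<in> \<Phi>"
    and v: "\<And>k. k \<in> I \<Longrightarrow> v k \<in> A"
    and v0: "\<And>S. S \<subset> I \<Longrightarrow> f (\<Sum>k\<in>S. v k) = 0" and v1: "f (\<Sum>k\<in>I. v k) \<noteq> 0"
  shows "\<exists>y\<in>\<Phi>. f y \<noteq> 0"
proof (rule ccontr)
  assume "\<not> ?thesis"
  then have van: "\<And>y. y \<in> \<Phi> \<Longrightarrow> f y = 0" by blast
  define bij where "bij = {g. g \<in> I \<rightarrow>\<^sub>E I \<and> g ` I = I}"
  \<comment> \<open>The full polarization of \<open>f\<close>: each \<open>j\<close> contributes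
    \<open>s j\<close> times the permanent of the matrix \<open>L j i (w k)\<close>. No factorial is
    divided out, so every characteristic is allowed.\<close>
  define Q where "Q w = (\<Sum>j\<in>J. s j * (\<Sum>g\<in>bij. \<Prod>i\<in>I. L j i (w (g i))))" for w
  have pair: "vector_space_pair sc ((*) :: 'k \<Rightarrow> 'k \<Rightarrow> 'k)"
    by (intro vector_space_pair.intro sc) (unfold_locales, auto simp: algebra_simps)
  have Q: "Q w = (\<Sum>S\<in>Pow I. (-1) ^ card (I - S) * f (\<Sum>k\<in>S. w k))" for w
  proof -
    have "L j i (\<Sum>k\<in>S. w k) = (\<Sum>k\<in>S. L j i (w k))" if "j \<in> J" "i \<in> I" for j i S
      using lin[OF that] by (rule vector_space_pair.linear_sum[OF pair])
    then have "f (\<Sum>k\<in>S. w k) = (\<Sum>j\<in>J. s j * (\<Prod>i\<in>I. \<Sum>k\<in>S. L j i (w k)))" for S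
      unfolding f by (intro sum.cong[OF refl] arg_cong2[where f = "(*)"] prod.cong refl) blast
    then have "(\<Sum>S\<in>Pow I. (-1) ^ card (I - S) * f (\<Sum>k\<in>S. w k)) =
      (\<Sum>S\<in>Pow I. \<Sum>j\<in>J. s j * ((-1) ^ card (I - S) * (\<Prod>i\<in>I. \<Sum>k\<in>S. L j i (w k))))"
      by (simp only: sum_distrib_left mult.left_commute)
    also have "\<dots> = Q w"
      unfolding Q_def bij_def
      by (subst sum.swap) (simp add: sum_distrib_left[symmetric] ryser[OF I, of "\<lambda>i k. L _ i (w k)"])
    finally show ?thesis ..
  qed
  \<comment> \<open>A surjective \<open>g\<close> permutes the finite set \<open>I\<close>, so slot
    \<open>k\<close> enters exactly one factor, the one with \<open>g i = k\<close>.\<close>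
  have Qlin: "Vector_Spaces.linear sc (*) (\<lambda>x. Q (w(k := x)))" if k: "k \<in> I" for w k
    unfolding Q_def
  proof (intro vector_space_pair.linear_compose_sum[OF pair] ballI vector_space_pair.linear_compose_scale_right[OF pair])
    fix j g assume j: "j \<in> J" and g: "g \<in> bij"
    then have "k \<in> g ` I" using k by (simp add: bij_def)
    then obtain i where i: "i \<in> I" "g i = k" by blast
    have inj: "inj_on g I" using g I by (intro eq_card_imp_inj_on) (auto simp: bij_def)
    have "(\<lambda>x. \<Prod>i\<in>I. L j i ((w(k := x)) (g i))) =
        (\<lambda>x. (\<Prod>i\<in>I - {i}. L j i (w (g i))) * L j i x)"
    proof
      fix x
      have "(\<Prod>i\<in>I - {i}. L j i ((w(k := x)) (g i))) = (\<Prod>i\<in>I - {i}. L j i (w (g i)))"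
        using i inj by (intro prod.cong) (auto simp: inj_on_def)
      then show "(\<Prod>i\<in>I. L j i ((w(k := x)) (g i))) = (\<Prod>i\<in>I - {i}. L j i (w (g i))) * L j i x"
        using i I by (subst prod.remove[of I i]) auto
    qed
    then show "Vector_Spaces.linear sc (*) (\<lambda>x. \<Prod>i\<in>I. L j i ((w(k := x)) (g i)))"
      using lin[OF j i(1)] by (simp add: vector_space_pair.linear_compose_scale_right[OF pair])
  qed
  \<comment> \<open>Slots are freed one at a time: those in \<open>T\<close> range over
    \<open>A\<close>, the others over \<Phi>. With all slots in \<Phi> every partial sum stays in
    \<Phi>; freeing slot \<open>k\<close> applies \<open>dense\<close> to the functional that
    \<open>Q\<close> defines there.\<close>
  have "Q w = 0" if "finite T" "T \<subseteq> I" "\<And>k. k \<in> I - T \<Longrightarrow> w k \<in> \<Phi>" "\<And>k. k \<in> T \<Longrightarrow> w k \<in> A" for T w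
    using that
  proof (induction T arbitrary: w rule: finite_induct)
    case empty
    have "(\<Sum>k\<in>S. w k) \<in> \<Phi>" if "finite S" "S \<subseteq> I" for S
      using that by (induction S rule: finite_induct) (use empty zero add in auto)
    then have "f (\<Sum>k\<in>S. w k) = 0" if "S \<in> Pow I" for S
      using van that I finite_subset by blast
    then show ?case unfolding Q by simp
  next
    case (insert k T)
    have "Q (w(k := y)) = 0" if "y \<in> \<Phi>" for y
      using that insert by (intro insert.IH) auto
    from dense[OF Qlin[of k w] this, of "w k"] have "Q (w(k := w k)) = 0"
      using insert.prems by simp
    then show ?case by simp
  qed
  from this[of I v] I v have "Q v = 0" by blast
  \<comment> \<open>By \<open>v0\<close> only the term \<open>S = I\<close> of the alternating sum
    survives, with sign 1.\<close>
  moreover have "Q v = f (\<Sum>k\<in>I. v k)"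
  proof -
    have "f (\<Sum>k\<in>S. v k) = 0" if "S \<in> Pow I - {I}" for S
      using that by (intro v0) blast
    then show ?thesis unfolding Q using I by (subst sum.remove[of _ I]) simp_all
  qed
  ultimately show False using v1 by simp
qed

section \<open>Linear algebra\<close>

context vector_space
begin

text \<open>Vectors are indexed, so a repetition already counts as a dependency: the non-injective
  case puts coefficients 1 and -1 on two equal vectors.\<close>

lemma nontrivial_relation:
  assumes T: "finite T" and I: "finite I" and card: "card T < card I"
    and v: "\<And>i. i \<in> I \<Longrightarrow> v i \<in> span T"
  obtains c where "\<exists>i\<in>I. c i \<noteq> 0" "(\<Sum>i\<in>I. scale (c i) (v i)) = 0"
proof (cases "inj_on v I")
  case True
  have "dependent (v ` I)"
    using independent_span_bound[OF T, of "v ` I"] v card card_image[OF True] by fastforce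
  then obtain u where u: "\<exists>x\<in>v ` I. u x \<noteq> 0" "(\<Sum>x\<in>v ` I. scale (u x) x) = 0"
    using I by (auto simp: dependent_finite)
  show thesis
  proof (rule that)
    show "\<exists>i\<in>I. u (v i) \<noteq> 0" using u(1) by blast
    show "(\<Sum>i\<in>I. scale (u (v i)) (v i)) = 0" using u(2) by (simp add: sum.reindex[OF True])
  qed
next
  case False
  then obtain i j where ij: "i \<in> I" "j \<in> I" "i \<noteq> j" "v i = v j" by (auto simp: inj_on_def)
  let ?c = "\<lambda>k. if k = i then 1 :: 'a else if k = j then -1 else 0"
  show thesis
  proof (rule that)
    show "\<exists>i\<in>I. ?c i \<noteq> 0" using ij by (intro bexI[of _ i]) auto
    have "(\<Sum>k\<in>I. scale (?c k) (v k)) = (\<Sum>k\<in>{i, j}. scale (?c k) (v k))"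
      using I ij by (intro sum.mono_neutral_right) auto
    then show "(\<Sum>k\<in>I. scale (?c k) (v k)) = 0" using ij by simp
  qed
qed

text \<open>The ambient space may have infinite dimension, so \<open>T\<close> is what makes
  \<open>dim\<close> meaningful. This provides the decreasing measure for the induction on
  composition factors.\<close>

lemma dim_psubset_of_finite_span:
  assumes T: "finite T" and C: "C \<subseteq> span T" and W: "subspace W" and WC: "W \<subset> C"
  shows "dim W < dim C"
proof -
  obtain B where B: "B \<subseteq> W" "independent B" "W \<subseteq> span B" "card B = dim W"
    using basis_exists by blast
  have "B \<subseteq> C" using B(1) WC by auto
  from maximal_independent_subset_extend[OF this B(2)] obtain B' where B': "B \<subseteq> B'" "B' \<subseteq> C" "independent B'" "C \<subseteq> span B'"
    by blast
  have fin: "finite B'" using independent_span_bound[OF T B'(3)] B' C by auto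
  have "B \<noteq> B'"
  proof
    assume "B = B'"
    then have "C \<subseteq> W" using B' span_minimal[OF B(1) W] by auto
    with WC show False by auto
  qed
  then have "card B < card B'" using fin B'(1) by (intro psubset_card_mono) auto
  moreover have "card B' = dim C" using basis_card_eq_dim[of B' C] B' by auto
  ultimately show ?thesis using B by simp
qed

end

text \<open>Some nonzero polynomial in \<open>c\<close> annihilates a given nonzero
  \<open>u\<close>. Splitting a linear factor off one of minimal degree leaves a cofactor that sends
  \<open>u\<close> to an eigenvector. Linearity of \<open>c\<close> is asked on \<open>U\<close>
  only, as suits an endomorphism defined by choice.\<close>

lemma exists_eigenvector:
  fixes scale :: "'k::alg_closed_field \<Rightarrow> 'v::ab_group_add \<Rightarrow> 'v"
  assumes vs: "vector_space scale"
    and U: "module.subspace scale U" and T: "finite T" "U \<subseteq> module.span scale T" and ne: "U \<noteq> {0}"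
    and cU: "\<And>x. x \<in> U \<Longrightarrow> c x \<in> U"
    and add: "\<And>x y. x \<in> U \<Longrightarrow> y \<in> U \<Longrightarrow> c (x + y) = c x + c y"
    and smult: "\<And>a x. x \<in> U \<Longrightarrow> c (scale a x) = scale a (c x)"
  obtains l u where "u \<in> U" "u \<noteq> 0" "c u = scale l u"
proof -
  interpret vector_space scale by (rule vs)
  have [simp]: "c 0 = 0" using smult[of 0 0] subspace_0[OF U] by simp
  obtain u where u: "u \<in> U" "u \<noteq> 0" using ne subspace_0[OF U] by auto
  \<comment> \<open>Horner evaluation of \<open>p\<close> at \<open>c\<close>, applied to
    \<open>u\<close>.\<close>
  define ev where "ev p = fold_coeffs (\<lambda>a y. scale a u + c y) p 0" for p :: "'k poly"
  have ev0: "ev 0 = 0" by (simp add: ev_def)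
  have evp: "ev (pCons a p) = scale a u + c (ev p)" for a p
    by (cases "p = 0 \<and> a = 0") (auto simp: ev_def)
  have evU: "ev p \<in> U" for p
    by (induction p) (auto simp: ev0 evp cU u subspace_add[OF U] subspace_scale[OF U] subspace_0[OF U])
  have ev_add: "ev (p + q) = ev p + ev q" for p q
    by (induction p q rule: poly_induct2) (auto simp: ev0 evp add evU scale_left_distrib algebra_simps)
  have ev_smult: "ev (smult b p) = scale b (ev p)" for b p
    by (induction p) (auto simp: ev0 evp smult evU scale_right_distrib)
  have ev_sum: "ev (sum f I) = (\<Sum>i\<in>I. ev (f i))" for f and I :: "nat set"
    by (induction I rule: infinite_finite_induct) (auto simp: ev0 ev_add)
  \<comment> \<open>The set \<open>{..card T}\<close> has one element more than \<open>T\<close>,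
    which forces a relation.\<close>
  obtain r where r: "\<exists>i\<in>{..card T}. r i \<noteq> 0" "(\<Sum>i\<in>{..card T}. scale (r i) (ev (monom 1 i))) = 0"
    by (rule nontrivial_relation[of T "{..card T}" "\<lambda>i. ev (monom 1 i)"]) (use T evU in auto)
  define p where "p = (\<Sum>i\<in>{..card T}. monom (r i) i)"
  have "coeff p i = (if i \<le> card T then r i else 0)" for i
    by (simp add: p_def coeff_sum)
  then have "p \<noteq> 0" using r(1) by (metis atMost_iff coeff_0)
  moreover have "ev p = 0"
    using r(2) by (simp add: p_def ev_sum ev_smult[symmetric] smult_monom)
  ultimately have ex: "\<exists>q. q \<noteq> 0 \<and> ev q = 0" by blast
  define q where "q = arg_min degree (\<lambda>q. q \<noteq> 0 \<and> ev q = 0)"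
  have q: "q \<noteq> 0" "ev q = 0" and qmin: "\<And>q'. q' \<noteq> 0 \<Longrightarrow> ev q' = 0 \<Longrightarrow> degree q \<le> degree q'"
    using arg_min_nat_lemma[of "\<lambda>q. q \<noteq> 0 \<and> ev q = 0", OF conjI, of p degree]
      \<open>p \<noteq> 0\<close> \<open>ev p = 0\<close> unfolding q_def by auto
  have "degree q > 0"
  proof (rule ccontr)
    assume "\<not> degree q > 0"
    then obtain a where "q = [:a:]" using degree_eq_zeroE by auto
    then show False using q u by (simp add: evp ev0)
  qed
  then obtain l where "poly q l = 0" using alg_closed_imp_poly_has_root by blast
  then obtain s where s: "q = [:-l, 1:] * s" by (auto simp: poly_eq_0_iff_dvd)
  with q have s0: "s \<noteq> 0" by auto
  then have "degree q = Suc (degree s)" unfolding s by (subst degree_mult_eq) auto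
  then have "ev s \<noteq> 0" using qmin[of s] s0 by auto
  moreover have "c (ev s) = scale l (ev s)"
  proof -
    have "q = smult (-l) s + pCons 0 s" by (simp add: s)
    then have "ev q = scale (-l) (ev s) + c (ev s)" by (simp only: ev_add ev_smult evp) simp
    then show ?thesis using q by (simp add: scale_minus_left)
  qed
  ultimately show thesis using that evU by blast
qed

lemma vector_space_field: "vector_space ((*) :: 'k::field \<Rightarrow> 'k \<Rightarrow> 'k)"
  by unfold_locales (auto simp: algebra_simps)

text \<open>The basis is numbered by naturals to provide matrix indices, and its coordinate
  functionals are extended from the span of \<open>B\<close> to the whole space.\<close>

lemma (in vector_space) dual_basis:
  assumes B: "finite B" "independent B"
  obtains n :: nat and e \<kappa> where "bij_betw e {..<n} B"
    "\<And>k. Vector_Spaces.linear scale (*) (\<kappa> k)"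
    "\<And>k l. k < n \<Longrightarrow> l < n \<Longrightarrow> \<kappa> k (e l) = (if k = l then 1 else 0)"
proof -
  have pair: "vector_space_pair scale ((*) :: 'a \<Rightarrow> 'a \<Rightarrow> 'a)"
    by (intro vector_space_pair.intro vector_space_field vector_space_axioms)
  obtain e where e: "bij_betw e {..<card B} B"
    using ex_bij_betw_nat_finite[OF B(1)] by (auto simp: atLeast0LessThan)
  have "\<exists>f. Vector_Spaces.linear scale ((*) :: 'a \<Rightarrow> 'a \<Rightarrow> 'a) f \<and> (\<forall>x\<in>B. f x = (if x = e k then 1 else 0))" for k
    by (rule vector_space_pair.linear_independent_extend[OF pair B(2)])
  then obtain \<kappa> where \<kappa>: "\<And>k. Vector_Spaces.linear scale ((*) :: 'a \<Rightarrow> 'a \<Rightarrow> 'a) (\<kappa> k)"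
      "\<And>k x. x \<in> B \<Longrightarrow> \<kappa> k x = (if x = e k then 1 else 0)"
    by metis
  show thesis
  proof (rule that[OF e \<kappa>(1)])
    fix k l assume kl: "k < card B" "l < card B"
    have "e l \<in> B" using bij_betwE[OF e] kl by simp
    moreover have "e l = e k \<longleftrightarrow> k = l"
      using inj_on_eq_iff[OF bij_betw_imp_inj_on[OF e], of l k] kl by auto
    ultimately show "\<kappa> k (e l) = (if k = l then 1 else 0)"
      by (simp add: \<kappa>(2))
  qed
qed

lemma det_eq_0_if_row_eq_0:
  assumes M: "M \<in> carrier_mat n n" and k: "k < n" and zero: "\<And>l. l < n \<Longrightarrow> M $$ (k, l) = 0"
  shows "det M = (0 :: 'k::field)"
proof -
  have "signof p * (\<Prod>i = 0..<n. M $$ (i, p i)) = 0" if "p permutes {0..<n}" for p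
  proof -
    have "p k < n" using permutes_in_image[OF that, of k] k by simp
    then have "(\<Prod>i = 0..<n. M $$ (i, p i)) = 0"
      using k zero by (intro prod_zero bexI[of _ k]) auto
    then show ?thesis by simp
  qed
  then show ?thesis unfolding det_def'[OF M] by (intro sum.neutral) blast
qed

section \<open>Coordinate spaces of functions on an index set\<close>

definition fun_scale :: "'k::field \<Rightarrow> ('i \<Rightarrow> 'k) \<Rightarrow> 'i \<Rightarrow> 'k" where
  "fun_scale c v = (\<lambda>i. c * v i)"

definition unit_fun :: "'i \<Rightarrow> 'i \<Rightarrow> 'k::field" where
  "unit_fun i = (\<lambda>j. if j = i then 1 else 0)"

text \<open>Models the coordinate space with index set \<open>I\<close> inside a type of total
  functions; the value 0 outside \<open>I\<close> makes the representing function unique.\<close>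

definition supported_on :: "'i set \<Rightarrow> ('i \<Rightarrow> 'k::field) set" where
  "supported_on I = {v. \<forall>i. i \<notin> I \<longrightarrow> v i = 0}"

lemma vector_space_fun_scale: "vector_space (fun_scale :: 'k::field \<Rightarrow> ('i \<Rightarrow> 'k) \<Rightarrow> 'i \<Rightarrow> 'k)"
  by unfold_locales (auto simp: fun_scale_def fun_eq_iff algebra_simps)

lemma sum_fun_apply: "(\<Sum>i\<in>I. f i) x = (\<Sum>i\<in>I. f i x)" for f :: "'i \<Rightarrow> 'j \<Rightarrow> 'k::comm_monoid_add"
  by (induction I rule: infinite_finite_induct) auto

lemma subspace_supported_on: "module.subspace fun_scale (supported_on I)"
proof -
  interpret vector_space fun_scale by (rule vector_space_fun_scale)
  show ?thesis by (rule subspaceI) (auto simp: supported_on_def fun_scale_def)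
qed

lemma supported_on_eq_sum:
  assumes I: "finite I" and v: "v \<in> supported_on I"
  shows "v = (\<Sum>i\<in>I. fun_scale (v i) (unit_fun i))"
proof
  fix j
  have "(\<Sum>i\<in>I. v i * unit_fun i j) = (\<Sum>i\<in>I. if j = i then v i else 0)"
    by (intro sum.cong) (auto simp: unit_fun_def)
  then show "v j = (\<Sum>i\<in>I. fun_scale (v i) (unit_fun i)) j"
    using I v by (simp add: sum_fun_apply fun_scale_def supported_on_def)
qed

lemma supported_on_subset_span:
  assumes "finite I"
  shows "(supported_on I :: ('i \<Rightarrow> 'k::field) set) \<subseteq> module.span fun_scale (unit_fun ` I)"
proof
  interpret vector_space "fun_scale :: 'k \<Rightarrow> ('i \<Rightarrow> 'k) \<Rightarrow> 'i \<Rightarrow> 'k" by (rule vector_space_fun_scale)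
  fix v :: "'i \<Rightarrow> 'k" assume "v \<in> supported_on I"
  from supported_on_eq_sum[OF assms this]
  show "v \<in> span (unit_fun ` I)"
    by (metis (no_types, lifting) imageI span_base span_scale span_sum)
qed

text \<open>Subtracting \<open>\<chi> j y\<close> times the relation at \<open>x\<close> from the
  relation at \<open>y * x\<close> eliminates \<open>j\<close>. With \<open>y\<close> chosen so that
  \<open>\<chi> i y\<close> and \<open>\<chi> j y\<close> differ, induction kills
  \<open>c i\<close>; evaluation at 1 then kills \<open>c j\<close>.\<close>

lemma dedekind_independence:
  fixes \<chi> :: "'i \<Rightarrow> 'm::monoid_mult \<Rightarrow> 'k::field"
  assumes "finite I"
    and "\<And>i x y. i \<in> I \<Longrightarrow> \<chi> i (x * y) = \<chi> i x * \<chi> i y" and "\<And>i. i \<in> I \<Longrightarrow> \<chi> i 1 = 1"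
    and "inj_on \<chi> I"
    and "\<And>x. (\<Sum>i\<in>I. c i * \<chi> i x) = 0"
  shows "i \<in> I \<Longrightarrow> c i = 0"
  using assms
proof (induction I arbitrary: c i rule: finite_induct)
  case empty
  then show ?case by simp
next
  case (insert j I)
  have c: "c i = 0" if i: "i \<in> I" for i
  proof -
    have "\<chi> i \<noteq> \<chi> j" using insert.prems(4) insert.hyps(2) i by (auto simp: inj_on_def)
    then obtain y where y: "\<chi> i y \<noteq> \<chi> j y" by blast
    have "(\<Sum>i\<in>I. c i * (\<chi> i y - \<chi> j y) * \<chi> i x) = 0" for x
    proof -
      have "(\<Sum>i\<in>insert j I. c i * \<chi> i (y * x)) - \<chi> j y * (\<Sum>i\<in>insert j I. c i * \<chi> i x) = 0"
        by (simp only: insert.prems(5) mult_zero_right diff_self)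
      moreover have "c i * (\<chi> i y - \<chi> j y) * \<chi> i x = c i * \<chi> i (y * x) - \<chi> j y * (c i * \<chi> i x)"
        if "i \<in> insert j I" for i
        using insert.prems(2)[OF that] by (simp add: algebra_simps)
      ultimately have "(\<Sum>i\<in>insert j I. c i * (\<chi> i y - \<chi> j y) * \<chi> i x) = 0"
        by (simp add: sum_distrib_left sum_subtractf del: sum.insert)
      then show ?thesis using insert.hyps by simp
    qed
    then have "c i * (\<chi> i y - \<chi> j y) = 0"
      using insert.prems(2,3,4) i by (intro insert.IH[of i "\<lambda>i. c i * (\<chi> i y - \<chi> j y)"]) auto
    then show ?thesis using y by simp
  qed
  have "c j = 0" using insert.prems(5)[of 1] insert.prems(3) insert.hyps c by simp
  then show ?case using c insert.prems(1) by blast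
qed

section \<open>Algebras acting on a finite-dimensional space\<close>

locale algebra_action = V: vector_space scale + R: vector_space scaleA
  for scale :: "'k::alg_closed_field \<Rightarrow> 'v::ab_group_add \<Rightarrow> 'v"
    and scaleA :: "'k \<Rightarrow> 'a::ab_group_add \<Rightarrow> 'a" +
  fixes A :: "'a set" and mul :: "'a \<Rightarrow> 'a \<Rightarrow> 'a" and one :: 'a
  assumes subspace_A: "R.subspace A"
    and mul_A: "a \<in> A \<Longrightarrow> b \<in> A \<Longrightarrow> mul a b \<in> A"
    and one_A: "one \<in> A"
begin

sublocale VV: vector_space_pair scale scale ..
sublocale RV: vector_space_pair scaleA scale ..

text \<open>Linearity in each argument is total, to match the linear maps of the library, while the
  action laws hold on \<open>C\<close> only. Submodules and quotients can thus be carried by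
  subspaces of one type.\<close>

definition rep :: "'v set \<Rightarrow> ('a \<Rightarrow> 'v \<Rightarrow> 'v) \<Rightarrow> bool" where
  "rep C \<rho> \<longleftrightarrow> V.subspace C \<and> (\<forall>a. Vector_Spaces.linear scale scale (\<rho> a)) \<and>
     (\<forall>x. Vector_Spaces.linear scaleA scale (\<lambda>a. \<rho> a x)) \<and>
     (\<forall>a\<in>A. \<forall>x\<in>C. \<rho> a x \<in> C) \<and>
     (\<forall>a\<in>A. \<forall>b\<in>A. \<forall>x\<in>C. \<rho> (mul a b) x = \<rho> a (\<rho> b x)) \<and> (\<forall>x\<in>C. \<rho> one x = x)"

text \<open>Irreducibility is expressed as transitivity, every nonzero vector generating
  \<open>C\<close>, which is the form that density uses.\<close>

definition irreducible_rep :: "'v set \<Rightarrow> ('a \<Rightarrow> 'v \<Rightarrow> 'v) \<Rightarrow> bool" where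
  "irreducible_rep C \<rho> \<longleftrightarrow> rep C \<rho> \<and> C \<noteq> {0} \<and>
     (\<forall>u\<in>C. u \<noteq> 0 \<longrightarrow> (\<forall>w\<in>C. \<exists>a\<in>A. \<rho> a u = w))"

definition injective_on :: "'v set \<Rightarrow> ('v \<Rightarrow> 'v) \<Rightarrow> bool" where
  "injective_on C f \<longleftrightarrow> (\<forall>x\<in>C. f x = 0 \<longrightarrow> x = 0)"

context
  fixes C \<rho>
  assumes rep: "rep C \<rho>"
begin

lemma rep_subspace: "V.subspace C"
  and rep_linear: "Vector_Spaces.linear scale scale (\<rho> a)"
  and rep_linear_alg: "Vector_Spaces.linear scaleA scale (\<lambda>a. \<rho> a x)"
  and rep_closed: "a \<in> A \<Longrightarrow> x \<in> C \<Longrightarrow> \<rho> a x \<in> C"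
  and rep_mul: "a \<in> A \<Longrightarrow> b \<in> A \<Longrightarrow> x \<in> C \<Longrightarrow> \<rho> (mul a b) x = \<rho> a (\<rho> b x)"
  and rep_one: "x \<in> C \<Longrightarrow> \<rho> one x = x"
  using rep by (auto simp: rep_def)

lemma rep_diff: "\<rho> a (x - y) = \<rho> a x - \<rho> a y"
  and rep_scale: "\<rho> a (scale c x) = scale c (\<rho> a x)"
  and rep_zero: "\<rho> a 0 = 0"
  using VV.linear_diff[OF rep_linear] VV.linear_scale[OF rep_linear]
    VV.linear_0[OF rep_linear] by auto

lemma rep_add_alg: "\<rho> (a + b) x = \<rho> a x + \<rho> b x"
  and rep_diff_alg: "\<rho> (a - b) x = \<rho> a x - \<rho> b x"
  and rep_scale_alg: "\<rho> (scaleA c a) x = scale c (\<rho> a x)"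
  and rep_zero_alg: "\<rho> 0 x = 0"
  and rep_sum_alg: "\<rho> (sum g I) x = (\<Sum>i\<in>I. \<rho> (g i) x)"
  using RV.linear_add[OF rep_linear_alg] RV.linear_diff[OF rep_linear_alg]
    RV.linear_scale[OF rep_linear_alg] RV.linear_0[OF rep_linear_alg]
    RV.linear_sum[OF rep_linear_alg] by auto

text \<open>
  Jacobson density, with \<open>J\<close> possibly without unit. If every \<open>b\<close> annihilating \<open>U\<close> and \<open>y\<close> also
  annihilates \<open>x\<close>, then \<open>b y \<mapsto> b x\<close> is a well-defined endomorphism \<open>\<theta>\<close> of \<open>C\<close>
  commuting with \<open>J\<close>; by Schur's lemma it is a scalar \<open>l\<close>, and \<open>x - l y\<close> contradicts the
  induction hypothesis.
\<close>

lemma density_step: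
  assumes J: "J \<subseteq> A" "R.subspace J" "\<And>a b. a \<in> J \<Longrightarrow> b \<in> J \<Longrightarrow> mul a b \<in> J"
    and trans: "\<And>u w. u \<in> C \<Longrightarrow> u \<noteq> 0 \<Longrightarrow> w \<in> C \<Longrightarrow> \<exists>b\<in>J. \<rho> b u = w"
    and T: "finite T" "C \<subseteq> V.span T"
    and U: "finite U" "U \<subseteq> C" and x: "x \<in> C" "x \<notin> V.span U"
  shows "\<exists>b\<in>J. (\<forall>u\<in>U. \<rho> b u = 0) \<and> \<rho> b x \<noteq> 0"
  using U x
proof (induction U arbitrary: x rule: finite_induct)
  case empty
  then have "x \<noteq> 0" by (auto simp: V.span_zero)
  then obtain b where "b \<in> J" "\<rho> b x = x" using trans[of x x] empty by blast
  with \<open>x \<noteq> 0\<close> show ?case by (intro bexI[of _ b]) auto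
next
  case (insert y U)
  have y: "y \<in> C" using insert by simp
  show ?case
  proof (cases "y \<in> V.span U")
    case True
    then have "x \<notin> V.span U" using insert.prems by (simp add: V.span_redundant)
    with insert.IH[of x] insert.prems
    obtain b where b: "b \<in> J" "\<forall>u\<in>U. \<rho> b u = 0" "\<rho> b x \<noteq> 0" by blast
    then have "\<rho> b y = 0" using VV.linear_eq_0_on_span[OF rep_linear _ True] by blast
    with b show ?thesis by auto
  next
    case False
    \<comment> \<open>The annihilator of \<open>U\<close> in \<open>J\<close>, stable under left
      multiplication by \<open>J\<close>. By the induction hypothesis for \<open>y\<close> it does
      not kill \<open>y\<close>, so by transitivity it carries \<open>y\<close> onto all of
      \<open>C\<close>.\<close>
    define L where "L = {b \<in> J. \<forall>u\<in>U. \<rho> b u = 0}"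
    show ?thesis
    proof (rule ccontr)
      assume "\<not> ?thesis"
      then have kill: "\<rho> b x = 0" if "b \<in> L" "\<rho> b y = 0" for b
        using that by (auto simp: L_def)
      have L_add: "a + b \<in> L" and L_diff: "a - b \<in> L" and L_scale: "scaleA c a \<in> L"
        if "a \<in> L" "b \<in> L" for a b c
        using that J(2) by (auto simp: L_def rep_add_alg rep_diff_alg rep_scale_alg
            R.subspace_add R.subspace_diff R.subspace_scale)
      have LA: "b \<in> L \<Longrightarrow> b \<in> A" for b using J(1) by (auto simp: L_def)
      have L_mul: "mul a b \<in> L" if "a \<in> J" "b \<in> L" for a b
        using that J insert.prems(1) by (auto simp: L_def rep_mul rep_zero subset_iff)
      obtain b0 where b0: "b0 \<in> L" "\<rho> b0 y \<noteq> 0"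
        using insert.IH[OF _ y False] insert.prems by (auto simp: L_def)
      have onto: "\<exists>b\<in>L. \<rho> b y = z" if z: "z \<in> C" for z
      proof -
        obtain a where "a \<in> J" "\<rho> a (\<rho> b0 y) = z"
          using trans[OF rep_closed[OF LA[OF b0(1)] y] b0(2) z] by blast
        then show ?thesis using L_mul[of a b0] b0 LA y J(1)
          by (intro bexI[of _ "mul a b0"]) (auto simp: rep_mul subset_iff)
      qed
      \<comment> \<open>The choice of \<open>b\<close> is harmless: two candidates differ by an
        element of \<open>L\<close> that annihilates \<open>y\<close>, hence also \<open>x\<close>
        by \<open>kill\<close>.\<close>
      define \<theta> where "\<theta> z = \<rho> (SOME b. b \<in> L \<and> \<rho> b y = z) x" for z
      have \<theta>: "\<theta> (\<rho> b y) = \<rho> b x" if b: "b \<in> L" for b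
      proof -
        define b' where "b' = (SOME b'. b' \<in> L \<and> \<rho> b' y = \<rho> b y)"
        have "b' \<in> L \<and> \<rho> b' y = \<rho> b y" unfolding b'_def using b by (intro someI) auto
        then have "\<rho> (b' - b) x = 0" using b by (intro kill L_diff) (auto simp: rep_diff_alg)
        then show ?thesis by (simp add: \<theta>_def b'_def rep_diff_alg)
      qed
      have \<theta>_add: "\<theta> (z + z') = \<theta> z + \<theta> z'" if z: "z \<in> C" and z': "z' \<in> C" for z z'
      proof -
        obtain b where "b \<in> L" "\<rho> b y = z" using onto[OF z] by blast
        moreover obtain b' where "b' \<in> L" "\<rho> b' y = z'" using onto[OF z'] by blast
        ultimately show ?thesis using \<theta>[of "b + b'"] \<theta> L_add by (auto simp: rep_add_alg)
      qed
      have \<theta>_scale: "\<theta> (scale c z) = scale c (\<theta> z)" if z: "z \<in> C" for c z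
      proof -
        obtain b where "b \<in> L" "\<rho> b y = z" using onto[OF z] by blast
        then show ?thesis using \<theta>[of "scaleA c b"] \<theta> L_scale by (auto simp: rep_scale_alg)
      qed
      have \<theta>_comm: "\<theta> (\<rho> a z) = \<rho> a (\<theta> z)" if z: "z \<in> C" and a: "a \<in> J" for a z
      proof -
        obtain b where b: "b \<in> L" "\<rho> b y = z" using onto[OF z] by blast
        moreover have "a \<in> A" using a J(1) by auto
        ultimately show ?thesis
          using \<theta>[OF L_mul[OF a b(1)]] \<theta>[OF b(1)] LA[of b] y insert.prems(2)
          by (simp only: rep_mul)
      qed
      have \<theta>_closed: "\<theta> z \<in> C" if z: "z \<in> C" for z
      proof -
        obtain b where "b \<in> L" "\<rho> b y = z" using onto[OF z] by blast
        then show ?thesis using \<theta> rep_closed[OF LA insert.prems(2)] by auto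
      qed
      have "C \<noteq> {0}" using y False by (auto simp: V.span_zero)
      obtain l u where u: "u \<in> C" "u \<noteq> 0" "\<theta> u = scale l u"
        by (rule exists_eigenvector[OF V.vector_space_axioms rep_subspace T \<open>C \<noteq> {0}\<close> \<theta>_closed \<theta>_add \<theta>_scale])
      \<comment> \<open>One eigenvector suffices: transitivity writes \<open>\<rho> b y\<close> as
        \<open>\<rho> a u\<close>, and \<theta> commutes with \<open>a\<close>, so \<theta>
        multiplies \<open>\<rho> b y\<close> by \<open>l\<close>.\<close>
      have "\<rho> b (x - scale l y) = 0" if b: "b \<in> L" for b
      proof -
        obtain a where a: "a \<in> J" "\<rho> a u = \<rho> b y"
          using trans[OF u(1,2) rep_closed[OF LA[OF b] y]] by blast
        have "\<rho> b x = \<theta> (\<rho> a u)" using \<theta>[OF b] a by simp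
        also have "\<dots> = scale l (\<rho> b y)" using \<theta>_comm[OF u(1) a(1)] u a by (simp add: rep_scale)
        finally show ?thesis by (simp add: rep_diff rep_scale)
      qed
      then have "x - scale l y \<in> V.span U"
        using insert.IH[of "x - scale l y"] insert.prems y rep_subspace
        by (auto simp: L_def V.subspace_diff V.subspace_scale)
      then show False using insert.prems(3) by (auto simp: V.span_insert)
    qed
  qed
qed

text \<open>For each basis vector \<open>e\<close>, \<open>density_step\<close> yields an element of
  \<open>J\<close> that kills the other basis vectors but not \<open>e\<close>; transitivity moves
  its value at \<open>e\<close> to \<open>g e\<close>. The resulting elements are added up.\<close>

lemma density:
  assumes J: "J \<subseteq> A" "R.subspace J" "\<And>a b. a \<in> J \<Longrightarrow> b \<in> J \<Longrightarrow> mul a b \<in> J"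
    and trans: "\<And>u w. u \<in> C \<Longrightarrow> u \<noteq> 0 \<Longrightarrow> w \<in> C \<Longrightarrow> \<exists>b\<in>J. \<rho> b u = w"
    and B: "finite B" "V.independent B" "C = V.span B" and g: "g ` B \<subseteq> C"
  shows "\<exists>b\<in>J. \<forall>e\<in>B. \<rho> b e = g e"
proof -
  have BC: "B \<subseteq> C" using B(3) V.span_superset by auto
  have "\<exists>b\<in>J. \<rho> b e = g e \<and> (\<forall>u\<in>B - {e}. \<rho> b u = 0)" if e: "e \<in> B" for e
  proof -
    have "e \<notin> V.span (B - {e})" using B(2) e by (auto simp: V.dependent_def)
    then obtain b where b: "b \<in> J" "\<forall>u\<in>B - {e}. \<rho> b u = 0" "\<rho> b e \<noteq> 0"
      using density_step[OF J trans B(1), of "B - {e}" e] B BC e by auto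
    have "\<rho> b e \<in> C" using rep_closed[of b e] b J(1) BC e by auto
    then obtain a where "a \<in> J" "\<rho> a (\<rho> b e) = g e" using trans[of "\<rho> b e" "g e"] b g e by auto
    then show ?thesis using b J e BC
      by (intro bexI[of _ "mul a b"]) (auto simp: rep_mul rep_zero subset_iff)
  qed
  then obtain c where c: "\<And>e. e \<in> B \<Longrightarrow> c e \<in> J" "\<And>e. e \<in> B \<Longrightarrow> \<rho> (c e) e = g e"
    "\<And>e u. e \<in> B \<Longrightarrow> u \<in> B \<Longrightarrow> u \<noteq> e \<Longrightarrow> \<rho> (c e) u = 0"
    by (metis Diff_iff singletonD)
  have "\<rho> (\<Sum>e\<in>B. c e) u = g u" if "u \<in> B" for u
  proof -
    have "(\<Sum>e\<in>B. \<rho> (c e) u) = \<rho> (c u) u"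
      using B(1) that c(3) by (subst sum.remove[of B u]) (auto intro!: sum.neutral)
    then show ?thesis using c(2) that by (simp add: rep_sum_alg)
  qed
  moreover have "(\<Sum>e\<in>B. c e) \<in> J" using c J(2) by (simp add: R.subspace_sum)
  ultimately show ?thesis by blast
qed

end

section \<open>Composition factors\<close>

text \<open>Induction on the dimension, splitting \<open>C\<close> along the submodule generated by
  a vector that does not generate \<open>C\<close>. The quotient is modelled on a complement, and an
  element injective on submodule and quotient is injective on \<open>C\<close>.\<close>

lemma composition_factors:
  assumes T: "finite T"
  shows "rep C \<rho> \<Longrightarrow> C \<subseteq> V.span T \<Longrightarrow>
    \<exists>R. finite R \<and> (\<forall>(D, \<tau>)\<in>R. irreducible_rep D \<tau> \<and> D \<subseteq> C) \<and>
      (\<forall>a\<in>A. (\<forall>(D, \<tau>)\<in>R. injective_on D (\<tau> a)) \<longrightarrow> injective_on C (\<rho> a))"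
proof (induction "V.dim C" arbitrary: C \<rho> rule: less_induct)
  case less
  note rep = less.prems(1) and C = less.prems(2)
  note sub = rep_subspace[OF rep]
  consider "C = {0}" | "irreducible_rep C \<rho>" | "C \<noteq> {0}" "\<not> irreducible_rep C \<rho>" by blast
  then show ?case
  proof cases
    case 1
    then show ?thesis by (intro exI[of _ "{}"]) (auto simp: injective_on_def)
  next
    case 2
    then show ?thesis by (intro exI[of _ "{(C, \<rho>)}"]) auto
  next
    case 3
    then obtain u w where u: "u \<in> C" "u \<noteq> 0" and w: "w \<in> C" "\<And>a. a \<in> A \<Longrightarrow> \<rho> a u \<noteq> w"
      using rep unfolding irreducible_rep_def by blast
    define W where "W = (\<lambda>a. \<rho> a u) ` A"
    have W: "V.subspace W" unfolding W_def
      by (rule RV.linear_subspace_image[OF rep_linear_alg[OF rep] subspace_A])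
    have WC: "W \<subset> C" using w rep_closed[OF rep _ u(1)] by (auto simp: W_def)
    have uW: "u \<in> W" unfolding W_def using one_A rep_one[OF rep u(1)] by force
    have W_inv: "\<rho> a x \<in> W" if "a \<in> A" "x \<in> W" for a x
    proof -
      obtain b where b: "b \<in> A" "x = \<rho> b u" using \<open>x \<in> W\<close> by (auto simp: W_def)
      then have "\<rho> a x = \<rho> (mul a b) u" using rep_mul[OF rep that(1) b(1) u(1)] by simp
      then show ?thesis using mul_A[OF that(1) b(1)] unfolding W_def by blast
    qed
    \<comment> \<open>A linear projection onto \<open>W\<close>. Its kernel \<open>D\<close> in
      \<open>C\<close> stands for the quotient; the action \<open>\<tau>\<close> there is \<rho>
      with the \<open>W\<close>-component removed.\<close>
    obtain \<pi> where \<pi>: "range \<pi> \<subseteq> W" "Vector_Spaces.linear scale scale \<pi>" "\<And>x. x \<in> W \<Longrightarrow> \<pi> x = x"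
      using VV.linear_exists_left_inverse_on[OF V.linear_id W] by (auto simp: id_def)
    have \<pi>W: "\<pi> x \<in> W" for x using \<pi>(1) by auto
    define D where "D = {x \<in> C. \<pi> x = 0}"
    define \<tau> where "\<tau> a x = \<rho> a x - \<pi> (\<rho> a x)" for a x
    have D: "V.subspace D"
      using VV.linear_subspace_kernel[OF \<pi>(2)] V.subspace_inter[OF sub] by (simp add: D_def Collect_conj_eq)
    have "u \<notin> D" using u \<pi>(3)[OF uW] by (simp add: D_def)
    moreover have "D \<subseteq> C" by (auto simp: D_def)
    ultimately have "D \<subset> C" using u(1) by blast
    have repW: "rep W \<rho>"
      using rep W W_inv WC by (auto simp: rep_def subset_iff)
    have \<tau>W: "\<tau> a x = 0" if "a \<in> A" "x \<in> W" for a x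
      using \<pi>(3)[OF W_inv[OF that]] by (simp add: \<tau>_def)
    have \<tau>_diff: "\<tau> a (x - y) = \<tau> a x - \<tau> a y" for a x y
      by (simp add: \<tau>_def rep_diff[OF rep] VV.linear_diff[OF \<pi>(2)])
    have repD: "rep D \<tau>"
      unfolding rep_def
    proof (intro conjI allI ballI D)
      show "Vector_Spaces.linear scale scale (\<tau> a)" for a
        unfolding \<tau>_def
        by (intro VV.linear_compose_sub rep_linear[OF rep]
            Vector_Spaces.linear_compose[OF rep_linear[OF rep] \<pi>(2), unfolded o_def])
      show "Vector_Spaces.linear scaleA scale (\<lambda>a. \<tau> a x)" for x
        unfolding \<tau>_def
        by (intro RV.linear_compose_sub rep_linear_alg[OF rep]
            Vector_Spaces.linear_compose[OF rep_linear_alg[OF rep] \<pi>(2), unfolded o_def])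
    next
      fix a x assume a: "a \<in> A" and x: "x \<in> D"
      show "\<tau> a x \<in> D"
        using rep_closed[OF rep a] x \<pi>W[of "\<rho> a x"] \<pi>(3)[OF \<pi>W] WC sub
        by (auto simp: D_def \<tau>_def VV.linear_diff[OF \<pi>(2)] intro!: V.subspace_diff)
    next
      fix a b x assume ab: "a \<in> A" "b \<in> A" and x: "x \<in> D"
      \<comment> \<open>The two arguments of \<open>\<tau> a\<close> differ by a vector of
        \<open>W\<close>, which it kills because \<open>W\<close> is invariant.\<close>
      have "\<tau> a (\<tau> b x) = \<tau> a (\<rho> b x)"
        unfolding \<tau>_def[of b] using \<tau>W[OF ab(1) \<pi>W] by (simp add: \<tau>_diff)
      then show "\<tau> (mul a b) x = \<tau> a (\<tau> b x)"
        using ab x by (simp add: \<tau>_def rep_mul[OF rep] D_def)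
    next
      fix x assume "x \<in> D"
      then show "\<tau> one x = x" by (simp add: \<tau>_def D_def rep_one[OF rep])
    qed
    have "W \<subseteq> V.span T" "D \<subseteq> V.span T" using WC \<open>D \<subset> C\<close> C by blast+
    note hypW = less.hyps[OF V.dim_psubset_of_finite_span[OF T C W WC] repW \<open>W \<subseteq> V.span T\<close>]
      and hypD = less.hyps[OF V.dim_psubset_of_finite_span[OF T C D \<open>D \<subset> C\<close>] repD \<open>D \<subseteq> V.span T\<close>]
    from hypW obtain R1 where "finite R1 \<and> (\<forall>(D, \<tau>)\<in>R1. irreducible_rep D \<tau> \<and> D \<subseteq> W) \<and>
      (\<forall>a\<in>A. (\<forall>(D, \<tau>)\<in>R1. injective_on D (\<tau> a)) \<longrightarrow> injective_on W (\<rho> a))" ..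
    then have R1: "finite R1" "\<forall>(D, \<tau>)\<in>R1. irreducible_rep D \<tau> \<and> D \<subseteq> W"
      "\<forall>a\<in>A. (\<forall>(D, \<tau>)\<in>R1. injective_on D (\<tau> a)) \<longrightarrow> injective_on W (\<rho> a)" by simp_all
    from hypD obtain R2 where "finite R2 \<and> (\<forall>(D', \<tau>)\<in>R2. irreducible_rep D' \<tau> \<and> D' \<subseteq> D) \<and>
      (\<forall>a\<in>A. (\<forall>(D', \<tau>)\<in>R2. injective_on D' (\<tau> a)) \<longrightarrow> injective_on D (\<tau> a))" ..
    then have R2: "finite R2" "\<forall>(D', \<tau>)\<in>R2. irreducible_rep D' \<tau> \<and> D' \<subseteq> D"
      "\<forall>a\<in>A. (\<forall>(D', \<tau>)\<in>R2. injective_on D' (\<tau> a)) \<longrightarrow> injective_on D (\<tau> a)" by simp_all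
    have "injective_on C (\<rho> a)" if a: "a \<in> A" and inj: "\<forall>(D, \<tau>)\<in>R1 \<union> R2. injective_on D (\<tau> a)" for a
      unfolding injective_on_def
    proof (intro ballI impI)
      fix x assume x: "x \<in> C" "\<rho> a x = 0"
      \<comment> \<open>The component of \<open>x\<close> in \<open>D\<close> is killed by
        \<open>\<tau> a\<close>, hence zero; so \<open>x\<close> lies in \<open>W\<close>, where
        \<open>\<rho> a\<close> is injective.\<close>
      have "x - \<pi> x \<in> D" using x \<pi>W[of x] \<pi>(3)[OF \<pi>W] WC sub
        by (auto simp: D_def VV.linear_diff[OF \<pi>(2)] intro!: V.subspace_diff)
      moreover have "\<tau> a (x - \<pi> x) = 0"
        using \<tau>W[OF a \<pi>W] x(2) VV.linear_0[OF \<pi>(2)] by (simp add: \<tau>_diff) (simp add: \<tau>_def)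
      moreover have "injective_on D (\<tau> a)" using R2(3) a inj by blast
      ultimately have "x - \<pi> x = 0" unfolding injective_on_def by blast
      then have "x \<in> W" using \<pi>W[of x] by simp
      moreover have "injective_on W (\<rho> a)" using R1(3) a inj by blast
      ultimately show "x = 0" using x(2) unfolding injective_on_def by blast
    qed
    then show ?thesis using R1(1,2) R2(1,2) WC \<open>D \<subset> C\<close>
      by (intro exI[of _ "R1 \<union> R2"]) blast
  qed
qed

section \<open>Annihilator ideals and irredundant families\<close>

definition killing :: "('v set \<times> ('a \<Rightarrow> 'v \<Rightarrow> 'v)) set \<Rightarrow> 'a set" where
  "killing R = {b \<in> A. \<forall>(D, \<tau>)\<in>R. \<forall>x\<in>D. \<tau> b x = 0}"

lemma killing_subset: "killing R \<subseteq> A"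
  by (auto simp: killing_def)

lemma killing_ideal:
  assumes R: "\<forall>(D, \<tau>)\<in>R. rep D \<tau>"
  shows "R.subspace (killing R)"
    and "a \<in> A \<Longrightarrow> b \<in> killing R \<Longrightarrow> mul a b \<in> killing R"
    and "a \<in> A \<Longrightarrow> b \<in> killing R \<Longrightarrow> mul b a \<in> killing R"
proof -
  show "R.subspace (killing R)"
  proof (rule R.subspaceI)
    show "0 \<in> killing R" using R R.subspace_0[OF subspace_A]
      by (auto simp: killing_def rep_zero_alg)
  next
    fix a b assume "a \<in> killing R" "b \<in> killing R"
    then show "a + b \<in> killing R" using R R.subspace_add[OF subspace_A]
      by (fastforce simp: killing_def rep_add_alg)
  next
    fix c a assume "a \<in> killing R"
    then show "scaleA c a \<in> killing R" using R R.subspace_scale[OF subspace_A]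
      by (fastforce simp: killing_def rep_scale_alg)
  qed
next
  assume ab: "a \<in> A" "b \<in> killing R"
  have bA: "b \<in> A" using ab by (simp add: killing_def)
  have "\<tau> (mul a b) x = 0 \<and> \<tau> (mul b a) x = 0" if "(D, \<tau>) \<in> R" "x \<in> D" for D \<tau> x
  proof -
    have r: "rep D \<tau>" using R that by auto
    have "\<tau> b x = 0" "\<tau> b (\<tau> a x) = 0"
      using ab that rep_closed[OF r ab(1) that(2)] by (auto simp: killing_def)
    then show ?thesis
      using rep_mul[OF r ab(1) bA that(2)] rep_mul[OF r bA ab(1) that(2)] rep_zero[OF r] by simp
  qed
  then show "mul a b \<in> killing R" "mul b a \<in> killing R"
    using mul_A[OF ab(1) bA] mul_A[OF bA ab(1)] by (auto simp: killing_def)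
qed

text \<open>A subfamily of least cardinality with the same annihilator. Isomorphic members share
  their annihilator, so irredundance takes the place of choosing one member per isomorphism
  class.\<close>

lemma exists_minimal_family:
  assumes "finite R"
  obtains S where "S \<subseteq> R" "killing S \<subseteq> killing R"
    "\<And>r. r \<in> S \<Longrightarrow> \<not> killing (S - {r}) \<subseteq> killing S"
proof -
  let ?P = "\<lambda>S. S \<subseteq> R \<and> killing S \<subseteq> killing R"
  obtain S where S: "?P S" "\<And>S'. ?P S' \<Longrightarrow> card S \<le> card S'"
    using ex_has_least_nat[of ?P R card] by auto
  have "\<not> killing (S - {r}) \<subseteq> killing S" if r: "r \<in> S" for r
  proof
    assume "killing (S - {r}) \<subseteq> killing S"
    then have "card S \<le> card (S - {r})" using S(1) by (intro S(2)) blast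
    moreover have "finite S" using S(1) assms finite_subset by blast
    ultimately show False using r by (metis card_Diff1_less not_le)
  qed
  with S(1) show thesis by (intro that[of S]) blast+
qed

lemma killing_insert: "killing (insert (D, \<tau>) R) = {b \<in> killing R. \<forall>x\<in>D. \<tau> b x = 0}"
  by (auto simp: killing_def)

definition minimal_family ::
  "('v set \<times> ('a \<Rightarrow> 'v \<Rightarrow> 'v)) set \<Rightarrow> 'v set \<Rightarrow> bool" where
  "minimal_family S T \<longleftrightarrow> finite S \<and> finite T \<and>
     (\<forall>(D, \<tau>)\<in>S. irreducible_rep D \<tau> \<and> D \<subseteq> V.span T) \<and>
     (\<forall>r\<in>S. \<not> killing (S - {r}) \<subseteq> killing S)"

context
  fixes S T
  assumes fam: "minimal_family S T"
begin

lemma family_irreducible: "(D, \<tau>) \<in> S \<Longrightarrow> irreducible_rep D \<tau>"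
  and family_span: "(D, \<tau>) \<in> S \<Longrightarrow> D \<subseteq> V.span T"
  and family_finite_span: "finite T" and family_finite: "finite S"
  and family_minimal: "r \<in> S \<Longrightarrow> \<not> killing (S - {r}) \<subseteq> killing S"
  using fam unfolding minimal_family_def by blast+

lemma family_rep: "(D, \<tau>) \<in> S \<Longrightarrow> rep D \<tau>"
  using family_irreducible by (simp add: irreducible_rep_def)

lemma family_basis:
  assumes "(D, \<tau>) \<in> S"
  obtains B where "finite B" "V.independent B" "D = V.span B"
proof -
  obtain B where B: "B \<subseteq> D" "V.independent B" "D \<subseteq> V.span B"
    by (rule V.maximal_independent_subset[of D])
  have "finite B" using V.independent_span_bound[OF family_finite_span B(2)] B(1) family_span[OF assms] by auto
  moreover have "D = V.span B" using B V.span_minimal[OF B(1) rep_subspace[OF family_rep[OF assms]]] by auto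
  ultimately show thesis using that B(2) by blast
qed

text \<open>By irredundance some \<open>b\<close> annihilating the other members acts nontrivially
  on \<open>D\<close>. Products of the form a' b a remain in this two-sided ideal and carry any
  nonzero vector to any vector of \<open>D\<close>, so density applies to the ideal itself.\<close>

lemma minimal_family_density:
  assumes r: "(D, \<tau>) \<in> S"
    and B: "finite B" "V.independent B" "D = V.span B" and g: "g ` B \<subseteq> D"
  shows "\<exists>b\<in>killing (S - {(D, \<tau>)}). \<forall>e\<in>B. \<tau> b e = g e"
proof -
  note rep = family_rep[OF r]
  let ?J = "killing (S - {(D, \<tau>)})"
  have reps: "\<forall>(D, \<tau>)\<in>S - {(D, \<tau>)}. rep D \<tau>" using family_rep by auto
  note ideal = killing_ideal[OF reps]
  obtain b where b: "b \<in> ?J" "b \<notin> killing S" using family_minimal[OF r] by blast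
  then obtain x where x: "x \<in> D" "\<tau> b x \<noteq> 0"
    using killing_insert[of D \<tau> "S - {(D, \<tau>)}"] insert_Diff[OF r] by auto
  have onto: "\<exists>a\<in>A. \<tau> a u = w" if "u \<in> D" "u \<noteq> 0" "w \<in> D" for u w
    using family_irreducible[OF r] that by (auto simp: irreducible_rep_def)
  show ?thesis
  proof (rule density[OF rep killing_subset ideal(1) _ _ B g])
    show "mul a b \<in> ?J" if "a \<in> ?J" "b \<in> ?J" for a b
      using ideal(2) that killing_subset by blast
    show "\<exists>b\<in>?J. \<tau> b u = w" if u: "u \<in> D" "u \<noteq> 0" and w: "w \<in> D" for u w
    proof -
      obtain a where a: "a \<in> A" "\<tau> a u = x" using onto[OF u x(1)] by blast
      have bA: "b \<in> A" using b(1) killing_subset by blast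
      obtain a' where a': "a' \<in> A" "\<tau> a' (\<tau> b x) = w"
        using onto[OF rep_closed[OF rep bA x(1)] x(2) w] by blast
      have "\<tau> (mul a' (mul b a)) u = w"
        using rep_mul[OF rep a'(1) mul_A[OF bA a(1)] u(1)] rep_mul[OF rep bA a(1) u(1)] a a' by simp
      then show ?thesis using ideal(2)[OF a'(1) ideal(3)[OF a(1) b(1)]] by blast
    qed
  qed
qed

text \<open>Each \<open>v i\<close> acts as zero on every member other than \<open>h i\<close>, so
  different blocks do not interact.\<close>

lemma rep_sum_killing:
  assumes I: "finite I" and r: "(D, \<tau>) \<in> S" and x: "x \<in> D"
    and v: "\<And>i. i \<in> I \<Longrightarrow> v i \<in> killing (S - {h i})"
  shows "\<tau> (\<Sum>i\<in>I. v i) x = (\<Sum>i | i \<in> I \<and> h i = (D, \<tau>). \<tau> (v i) x)"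
proof -
  have "\<tau> (v i) x = 0" if "i \<in> I" "h i \<noteq> (D, \<tau>)" for i
  proof -
    have "\<forall>(D, \<tau>)\<in>S - {h i}. \<forall>x\<in>D. \<tau> (v i) x = 0"
      using v[OF that(1)] by (simp add: killing_def)
    from bspec[OF this, of "(D, \<tau>)"] show ?thesis using that(2) r x by auto
  qed
  then show ?thesis unfolding rep_sum_alg[OF family_rep[OF r]]
    using I by (intro sum.mono_neutral_right) auto
qed

text \<open>Carries injectivity from the irredundant family to the discarded members. On each block
  density realises a left inverse of \<open>a\<close> by an algebra element. With \<open>c\<close>
  their sum, \<open>mul c a - one\<close> annihilates \<open>S\<close>, hence \<open>R\<close>, so
  \<open>c\<close> undoes \<open>a\<close> on \<open>D'\<close>.\<close>

lemma minimal_family_injective: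
  assumes a: "a \<in> A" and inj: "\<And>D \<tau>. (D, \<tau>) \<in> S \<Longrightarrow> injective_on D (\<tau> a)"
    and kill: "killing S \<subseteq> killing R" and R: "(D', \<tau>') \<in> R" and rep': "rep D' \<tau>'"
  shows "injective_on D' (\<tau>' a)"
proof -
  have "\<exists>b\<in>killing (S - {(D, \<tau>)}). \<forall>x\<in>D. \<tau> b (\<tau> a x) = x" if r: "(D, \<tau>) \<in> S" for D \<tau>
  proof -
    note rep = family_rep[OF r]
    have "inj_on (\<tau> a) D"
    proof (rule inj_onI)
      fix x y assume "x \<in> D" "y \<in> D" "\<tau> a x = \<tau> a y"
      then have "x - y \<in> D" "\<tau> a (x - y) = 0"
        using V.subspace_diff[OF rep_subspace[OF rep]] rep_diff[OF rep] by auto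
      then show "x = y" using inj[OF r] unfolding injective_on_def by fastforce
    qed
    then obtain g where g: "range g \<subseteq> D" "Vector_Spaces.linear scale scale g"
      "\<And>x. x \<in> D \<Longrightarrow> g (\<tau> a x) = x"
      using VV.linear_exists_left_inverse_on[OF rep_linear[OF rep] rep_subspace[OF rep]] by blast
    obtain B where B: "finite B" "V.independent B" "D = V.span B"
      by (rule family_basis[OF r])
    obtain b where b: "b \<in> killing (S - {(D, \<tau>)})" "\<And>e. e \<in> B \<Longrightarrow> \<tau> b e = g e"
      using minimal_family_density[OF r B, of g] g(1) by blast
    have "\<tau> b x = g x" if "x \<in> D" for x
      using VV.linear_eq_on[OF rep_linear[OF rep] g(2)] b(2) that B(3) by blast
    then show ?thesis using b(1) g(3) rep_closed[OF rep a] by (intro bexI[of _ b]) auto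
  qed
  then have "\<forall>r\<in>S. \<exists>b\<in>killing (S - {r}). \<forall>x\<in>fst r. snd r b (snd r a x) = x" by fastforce
  then obtain b where b: "\<And>r. r \<in> S \<Longrightarrow> b r \<in> killing (S - {r})"
    "\<And>r x. r \<in> S \<Longrightarrow> x \<in> fst r \<Longrightarrow> snd r (b r) (snd r a x) = x" by metis
  define c where "c = (\<Sum>r\<in>S. b r)"
  have c: "c \<in> A" unfolding c_def
    using b(1) killing_subset by (intro R.subspace_sum[OF subspace_A]) blast
  have ca: "mul c a \<in> A" by (rule mul_A[OF c a])
  have "mul c a - one \<in> killing S"
    unfolding killing_def
  proof (intro CollectI conjI ballI R.subspace_diff[OF subspace_A] ca one_A, clarify)
    fix D \<tau> x assume r: "(D, \<tau>) \<in> S" and x: "x \<in> D"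
    note rep = family_rep[OF r]
    have ax: "\<tau> a x \<in> D" by (rule rep_closed[OF rep a x])
    have "\<tau> c (\<tau> a x) = (\<Sum>i | i \<in> S \<and> i = (D, \<tau>). \<tau> (b i) (\<tau> a x))"
      unfolding c_def by (rule rep_sum_killing[OF family_finite r ax]) (rule b(1))
    also have "{i. i \<in> S \<and> i = (D, \<tau>)} = {(D, \<tau>)}" using r by auto
    finally have "\<tau> c (\<tau> a x) = x" using b(2)[OF r] x by simp
    then show "\<tau> (mul c a - one) x = 0"
      using rep_mul[OF rep c a x] rep_one[OF rep x] by (simp add: rep_diff_alg[OF rep])
  qed
  then have "mul c a - one \<in> killing R" using kill by blast
  then have "\<tau>' (mul c a) x = x" if "x \<in> D'" for x
    using R that rep_one[OF rep' that] by (auto simp: killing_def rep_diff_alg[OF rep'])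
  then have "\<tau>' c (\<tau>' a x) = x" if "x \<in> D'" for x
    using rep_mul[OF rep' c a that] that by simp
  then show ?thesis using rep_zero[OF rep'] unfolding injective_on_def by metis
qed

end

section \<open>Determinants and elements acting injectively\<close>

text \<open>The coordinates of a nonzero kernel vector would form a nonzero vector killed by the
  matrix.\<close>

lemma injective_on_if_det_nonzero:
  assumes rep: "rep D \<tau>" and e: "D = V.span (e ` {..<n})"
    and \<kappa>: "\<And>k. Vector_Spaces.linear scale (*) (\<kappa> k)"
    and det: "det (mat n n (\<lambda>(k, l). \<kappa> k (\<tau> x (e l)))) \<noteq> 0"
  shows "injective_on D (\<tau> x)"
  unfolding injective_on_def
proof (intro ballI impI, rule ccontr)
  fix y assume y: "y \<in> D" "\<tau> x y = 0" "y \<noteq> 0"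
  have pair: "vector_space_pair scale ((*) :: 'k \<Rightarrow> 'k \<Rightarrow> 'k)"
    by (intro vector_space_pair.intro vector_space_field V.vector_space_axioms)
  let ?M = "mat n n (\<lambda>(k, l). \<kappa> k (\<tau> x (e l)))"
  have "\<exists>c. y = (\<Sum>l<n. scale (c l) (e l))"
    using y(1) unfolding e
  proof (induction rule: V.span_induct_alt)
    case base
    show ?case by (intro exI[of _ "\<lambda>_. 0"]) simp
  next
    case (step a z w)
    then obtain l c where l: "l < n" "z = e l" and c: "w = (\<Sum>l<n. scale (c l) (e l))" by auto
    have "(\<Sum>i<n. scale (if i = l then a else 0) (e i)) = scale a z"
      using l by (subst sum.remove[of _ l]) auto
    then show ?case
      by (intro exI[of _ "\<lambda>i. (if i = l then a else 0) + c i"])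
        (simp add: c V.scale_left_distrib sum.distrib)
  qed
  then obtain c where c: "y = (\<Sum>l<n. scale (c l) (e l))" by blast
  have "?M *\<^sub>v vec n c = 0\<^sub>v n"
  proof (rule eq_vecI)
    fix k assume k: "k < dim_vec (0\<^sub>v n)"
    have "\<kappa> k (\<tau> x y) = (\<Sum>l<n. c l * \<kappa> k (\<tau> x (e l)))"
      unfolding c VV.linear_sum[OF rep_linear[OF rep]] vector_space_pair.linear_sum[OF pair \<kappa>]
      by (simp add: rep_scale[OF rep] vector_space_pair.linear_scale[OF pair \<kappa>])
    then have "(\<Sum>l<n. c l * \<kappa> k (\<tau> x (e l))) = 0"
      using y(2) vector_space_pair.linear_0[OF pair \<kappa>] by simp
    then show "(?M *\<^sub>v vec n c) $ k = 0\<^sub>v n $ k"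
      using k by (simp add: scalar_prod_def atLeast0LessThan mult.commute)
  qed simp
  moreover have "vec n c \<noteq> 0\<^sub>v n"
  proof
    assume "vec n c = 0\<^sub>v n"
    then have "c l = 0" if "l < n" for l
      using that by (metis index_vec index_zero_vec(1))
    then show False using c y(3) by simp
  qed
  ultimately show False
    using det det_0_iff_vec_prod_zero[of ?M n] by (metis mat_carrier vec_carrier)
qed

text \<open>The hypothesis \<open>dense\<close> says dually that \<open>A\<close> lies in the span
  of \<Phi>: Dedekind independence supplies it in this form and polarization consumes it. The form
  \<open>f\<close> is built on an irredundant family of composition factors.\<close>

theorem exists_injective_element:
  assumes \<Phi>: "\<Phi> \<subseteq> A" "0 \<in> \<Phi>" "\<And>x y. x \<in> \<Phi> \<Longrightarrow> y \<in> \<Phi> \<Longrightarrow> x + y \<in> \<Phi>"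
    and dense: "\<And>l x. Vector_Spaces.linear scaleA (*) l \<Longrightarrow> (\<And>y. y \<in> \<Phi> \<Longrightarrow> l y = 0) \<Longrightarrow>
      x \<in> A \<Longrightarrow> l x = 0"
    and rep: "rep C \<rho>" and T: "finite T" "C \<subseteq> V.span T"
  shows "\<exists>x\<in>\<Phi>. injective_on C (\<rho> x)"
proof -
  from composition_factors[OF T(1) rep T(2)]
  obtain R where R0: "finite R \<and> (\<forall>(D, \<tau>)\<in>R. irreducible_rep D \<tau> \<and> D \<subseteq> C) \<and>
      (\<forall>a\<in>A. (\<forall>(D, \<tau>)\<in>R. injective_on D (\<tau> a)) \<longrightarrow> injective_on C (\<rho> a))" ..
  have R: "finite R" "\<And>D \<tau>. (D, \<tau>) \<in> R \<Longrightarrow> irreducible_rep D \<tau>"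
    "\<And>D \<tau>. (D, \<tau>) \<in> R \<Longrightarrow> D \<subseteq> C"
    "\<And>a. a \<in> A \<Longrightarrow> (\<And>D \<tau>. (D, \<tau>) \<in> R \<Longrightarrow> injective_on D (\<tau> a)) \<Longrightarrow> injective_on C (\<rho> a)"
    using R0 by auto
  obtain S where S: "S \<subseteq> R" "killing S \<subseteq> killing R" "\<And>r. r \<in> S \<Longrightarrow> \<not> killing (S - {r}) \<subseteq> killing S"
    using exists_minimal_family[OF R(1)] by metis
  have irr: "irreducible_rep D \<tau>" and DT: "D \<subseteq> V.span T" if "(D, \<tau>) \<in> S" for D \<tau>
    using that S(1) R(2,3) T(2) by blast+
  have finS: "finite S" using S(1) R(1) finite_subset by blast
  have fam: "minimal_family S T"
    unfolding minimal_family_def using irr DT T(1) finS S(3) by blast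
  have repS: "rep D \<tau>" if "(D, \<tau>) \<in> S" for D \<tau> using irr[OF that] by (simp add: irreducible_rep_def)
  have "\<exists>(n::nat) e \<kappa>. inj_on e {..<n} \<and> V.independent (e ` {..<n}) \<and> fst r = V.span (e ` {..<n}) \<and>
      (\<forall>k. Vector_Spaces.linear scale (*) (\<kappa> k)) \<and>
      (\<forall>k<n. \<forall>l<n. \<kappa> k (e l) = (if k = l then 1 else 0))" if r: "r \<in> S" for r
  proof -
    obtain B where B: "finite B" "V.independent B" "fst r = V.span B"
      by (rule family_basis[OF fam, of "fst r" "snd r"]) (use r in auto)
    obtain n :: nat and e \<kappa> where "bij_betw e {..<n} B" "\<And>k. Vector_Spaces.linear scale (*) (\<kappa> k)"
      "\<And>k l. k < n \<Longrightarrow> l < n \<Longrightarrow> \<kappa> k (e l) = (if k = l then 1 else 0)"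
      using V.dual_basis[OF B(1,2)] by metis
    then show ?thesis using B by (intro exI[of _ n] exI[of _ e] exI[of _ \<kappa>]) (auto simp: bij_betw_def)
  qed
  then have "\<forall>r\<in>S. \<exists>(n::nat) e \<kappa>. inj_on e {..<n} \<and> V.independent (e ` {..<n}) \<and> fst r = V.span (e ` {..<n}) \<and>
      (\<forall>k. Vector_Spaces.linear scale (*) (\<kappa> k)) \<and>
      (\<forall>k<n. \<forall>l<n. \<kappa> k (e l) = (if k = l then 1 else 0))" ..
  from bchoice[OF this] obtain n :: "'v set \<times> ('a \<Rightarrow> 'v \<Rightarrow> 'v) \<Rightarrow> nat" where
    "\<forall>r\<in>S. \<exists>e \<kappa>. inj_on e {..<n r} \<and> V.independent (e ` {..<n r}) \<and> fst r = V.span (e ` {..<n r}) \<and>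
      (\<forall>k. Vector_Spaces.linear scale (*) (\<kappa> k)) \<and>
      (\<forall>k<n r. \<forall>l<n r. \<kappa> k (e l) = (if k = l then 1 else 0))" ..
  from bchoice[OF this] obtain e where
    "\<forall>r\<in>S. \<exists>\<kappa>. inj_on (e r) {..<n r} \<and> V.independent (e r ` {..<n r}) \<and> fst r = V.span (e r ` {..<n r}) \<and>
      (\<forall>k. Vector_Spaces.linear scale (*) (\<kappa> k)) \<and>
      (\<forall>k<n r. \<forall>l<n r. \<kappa> k (e r l) = (if k = l then 1 else 0))" ..
  from bchoice[OF this] obtain \<kappa> where coord:
    "\<forall>r\<in>S. inj_on (e r) {..<n r} \<and> V.independent (e r ` {..<n r}) \<and> fst r = V.span (e r ` {..<n r}) \<and>
      (\<forall>k. Vector_Spaces.linear scale (*) (\<kappa> r k)) \<and>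
      (\<forall>k<n r. \<forall>l<n r. \<kappa> r k (e r l) = (if k = l then 1 else 0))" ..
  then have inj_e: "\<And>r. r \<in> S \<Longrightarrow> inj_on (e r) {..<n r}"
    and indep: "\<And>r. r \<in> S \<Longrightarrow> V.independent (e r ` {..<n r})"
    and span: "\<And>r. r \<in> S \<Longrightarrow> fst r = V.span (e r ` {..<n r})"
    and lin: "\<And>r k. r \<in> S \<Longrightarrow> Vector_Spaces.linear scale (*) (\<kappa> r k)"
    and dual: "\<And>r k l. r \<in> S \<Longrightarrow> k < n r \<Longrightarrow> l < n r \<Longrightarrow> \<kappa> r k (e r l) = (if k = l then 1 else 0)"
    by blast+
  define M where "M r x = mat (n r) (n r) (\<lambda>(k, l). \<kappa> r k (snd r x (e r l)))" for r x
  define f where "f x = (\<Prod>r\<in>S. det (M r x))" for x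
  \<comment> \<open>One index per row of each block, so \<open>f\<close> has degree
    \<open>card I\<close>; the same indices label the diagonal matrix units \<open>v\<close>. A
    member of \<open>J\<close> picks a permutation for each block, and \<open>L P i\<close> is the
    entry in row \<open>i\<close> and the column given by \<open>P\<close>: the Leibniz expansions
    multiplied out.\<close>
  define I where "I = Sigma S (\<lambda>r. {0..<n r})"
  define J where "J = PiE S (\<lambda>r. {p. p permutes {0..<n r}})"
  define s :: "_ \<Rightarrow> 'k" where "s P = (\<Prod>r\<in>S. signof (P r))" for P :: "'v set \<times> ('a \<Rightarrow> 'v \<Rightarrow> 'v) \<Rightarrow> nat \<Rightarrow> nat"
  define L where "L P i x = \<kappa> (fst i) (snd i) (snd (fst i) x (e (fst i) (P (fst i) (snd i))))"
    for P :: "'v set \<times> ('a \<Rightarrow> 'v \<Rightarrow> 'v) \<Rightarrow> nat \<Rightarrow> nat" and i x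
  have finI: "finite I" using finS by (simp add: I_def)
  have Mc: "M r x \<in> carrier_mat (n r) (n r)" for r x by (simp add: M_def)
  have f_eq: "f x = (\<Sum>P\<in>J. s P * (\<Prod>i\<in>I. L P i x))" for x
  proof -
    have "f x = (\<Prod>r\<in>S. \<Sum>p | p permutes {0..<n r}. signof p * (\<Prod>k=0..<n r. M r x $$ (k, p k)))"
      unfolding f_def det_def'[OF Mc] ..
    also have "\<dots> = (\<Sum>P\<in>J. \<Prod>r\<in>S. signof (P r) * (\<Prod>k=0..<n r. M r x $$ (k, P r k)))"
      unfolding J_def by (rule prod_sum_PiE) (auto simp: finS finite_permutations)
    also have "\<dots> = (\<Sum>P\<in>J. s P * (\<Prod>i\<in>I. L P i x))"
    proof (rule sum.cong[OF refl])
      fix P assume P: "P \<in> J"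
      have "M r x $$ (k, P r k) = L P (r, k) x" if "r \<in> S" "k \<in> {0..<n r}" for r k
      proof -
        have "P r permutes {0..<n r}" using P that(1) by (auto simp: J_def)
        then have "P r k < n r" using permutes_in_image[of "P r" "{0..<n r}" k] that(2) by simp
        then show ?thesis using that by (simp add: M_def L_def)
      qed
      then have "(\<Prod>r\<in>S. \<Prod>k=0..<n r. M r x $$ (k, P r k)) = (\<Prod>r\<in>S. \<Prod>k=0..<n r. L P (r, k) x)"
        by (intro prod.cong refl) auto
      then show "(\<Prod>r\<in>S. signof (P r) * (\<Prod>k=0..<n r. M r x $$ (k, P r k))) = s P * (\<Prod>i\<in>I. L P i x)"
        by (simp add: prod.distrib s_def I_def prod.Sigma finS)
    qed
    finally show ?thesis .
  qed
  have linL: "Vector_Spaces.linear scaleA (*) (L P i)" if "i \<in> I" for P i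
  proof -
    have r: "fst i \<in> S" using that by (auto simp: I_def)
    have "Vector_Spaces.linear scaleA scale (\<lambda>x. snd (fst i) x (e (fst i) (P (fst i) (snd i))))"
      using rep_linear_alg[OF repS[of "fst (fst i)" "snd (fst i)"]] r by simp
    from Vector_Spaces.linear_compose[OF this lin[OF r]] show ?thesis
      unfolding L_def o_def .
  qed
  \<comment> \<open>For \<open>i = (r, k)\<close> this asks for the matrix unit at position
    \<open>(k, k)\<close> of block \<open>r\<close>, acting as zero on the other blocks.\<close>
  have "\<exists>b\<in>killing (S - {fst i}). \<forall>l<n (fst i). snd (fst i) b (e (fst i) l) =
      (if l = snd i then e (fst i) l else 0)" if i: "i \<in> I" for i
  proof -
    obtain r k where rk: "i = (r, k)" "r \<in> S" "k < n r" using i by (auto simp: I_def)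
    define g where "g x = (if x = e r k then x else 0)" for x
    have "g ` e r ` {..<n r} \<subseteq> fst r"
      unfolding span[OF rk(2)] using rk(3) by (auto simp: g_def V.span_zero intro: V.span_base)
    then obtain b where b: "b \<in> killing (S - {r})" "\<forall>x\<in>e r ` {..<n r}. snd r b x = g x"
      using minimal_family_density[OF fam _ _ indep[OF rk(2)] span[OF rk(2)], of "snd r" g]
        rk(2) by auto
    have "g (e r l) = (if l = k then e r l else 0)" if "l < n r" for l
      using inj_e[OF rk(2)] that rk(3) by (auto simp: g_def inj_on_def)
    then show ?thesis using b rk(1) by (intro bexI[of _ b]) auto
  qed
  then obtain v where v: "\<And>i. i \<in> I \<Longrightarrow> v i \<in> killing (S - {fst i})"
    "\<And>i l. i \<in> I \<Longrightarrow> l < n (fst i) \<Longrightarrow> snd (fst i) (v i) (e (fst i) l) =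
      (if l = snd i then e (fst i) l else 0)"
    by metis
  have M_v: "M r (\<Sum>i\<in>U. v i) $$ (k, l) = (if k = l \<and> (r, l) \<in> U then 1 else 0)"
    if U: "U \<subseteq> I" and r: "r \<in> S" and k: "k < n r" and l: "l < n r" for U r k l
  proof -
    have finU: "finite U" using U finI finite_subset by blast
    have el: "e r l \<in> fst r" using span[OF r] l by (simp add: V.span_base)
    have "snd r (\<Sum>i\<in>U. v i) (e r l) = (\<Sum>i | i \<in> U \<and> fst i = (fst r, snd r). snd r (v i) (e r l))"
      by (rule rep_sum_killing[OF fam finU]) (use r el v(1) U in auto)
    also have "\<dots> = (\<Sum>i | i \<in> U \<and> fst i = r. if i = (r, l) then e r l else 0)"
    proof (rule sum.cong)
      fix i assume i: "i \<in> {i \<in> U. fst i = r}"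
      then have "i \<in> I" "fst i = r" using U by auto
      then have "snd r (v i) (e r l) = (if l = snd i then e r l else 0)"
        using v(2)[of i l] l by simp
      moreover have "i = (r, l) \<longleftrightarrow> l = snd i" using \<open>fst i = r\<close> by (cases i) auto
      ultimately show "snd r (v i) (e r l) = (if i = (r, l) then e r l else 0)" by simp
    qed simp
    also have "\<dots> = (if (r, l) \<in> U then e r l else 0)"
      using finU by (simp add: sum.delta)
    finally have "M r (\<Sum>i\<in>U. v i) $$ (k, l) = \<kappa> r k (if (r, l) \<in> U then e r l else 0)"
      using k l by (simp add: M_def)
    moreover have "\<kappa> r k 0 = 0"
      by (rule vector_space_pair.linear_0[OF _ lin[OF r]])
        (intro vector_space_pair.intro vector_space_field V.vector_space_axioms)
    ultimately show ?thesis using dual[OF r k l] by (cases "(r, l) \<in> U"; cases "k = l") simp_all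
  qed
  \<comment> \<open>A missing index \<open>(r, k)\<close> leaves row \<open>k\<close> of block
    \<open>r\<close> zero, whereas the full sum gives identity matrices throughout.\<close>
  have f_U: "f (\<Sum>i\<in>U. v i) = 0" if U: "U \<subset> I" for U
  proof -
    obtain r k where rk: "(r, k) \<in> I" "(r, k) \<notin> U" using U by fastforce
    have r: "r \<in> S" "k < n r" using rk(1) by (auto simp: I_def)
    have "det (M r (\<Sum>i\<in>U. v i)) = 0"
      by (rule det_eq_0_if_row_eq_0[OF Mc r(2)]) (use M_v[of U r k] U r rk(2) in auto)
    then show ?thesis unfolding f_def using finS r(1) by (intro prod_zero) auto
  qed
  have f_I: "f (\<Sum>i\<in>I. v i) \<noteq> 0"
  proof -
    have "M r (\<Sum>i\<in>I. v i) = 1\<^sub>m (n r)" if r: "r \<in> S" for r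
    proof (rule eq_matI)
      fix k l assume "k < dim_row (1\<^sub>m (n r))" "l < dim_col (1\<^sub>m (n r))"
      then have kl: "k < n r" "l < n r" by simp_all
      then have "(r, l) \<in> I" using r by (simp add: I_def)
      then show "M r (\<Sum>i\<in>I. v i) $$ (k, l) = 1\<^sub>m (n r) $$ (k, l)"
        using M_v[OF subset_refl r kl] kl by simp
    qed (simp_all add: M_def)
    then show ?thesis unfolding f_def using finS by simp
  qed
  have "\<exists>x\<in>\<Phi>. f x \<noteq> 0"
  proof (rule polarization_nonzero[of I f s L J scaleA \<Phi> A v])
    show "v i \<in> A" if "i \<in> I" for i using v(1)[OF that] killing_subset by blast
    show "l x = 0" if "Vector_Spaces.linear scaleA (*) l" "\<And>y. y \<in> \<Phi> \<Longrightarrow> l y = 0" "x \<in> A" for l x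
      using that by (rule dense)
    show "Vector_Spaces.linear scaleA (*) (L P i)" if "i \<in> I" for P i using that by (rule linL)
    show "x + y \<in> \<Phi>" if "x \<in> \<Phi>" "y \<in> \<Phi>" for x y using that by (rule \<Phi>(3))
    show "f (\<Sum>i\<in>U. v i) = 0" if "U \<subset> I" for U using that by (rule f_U)
  qed (rule finI f_eq R.vector_space_axioms \<Phi>(2) f_I)+
  then obtain x where x: "x \<in> \<Phi>" "f x \<noteq> 0" by blast
  have xA: "x \<in> A" using x \<Phi>(1) by blast
  have "injective_on D (\<tau> x)" if "(D, \<tau>) \<in> S" for D \<tau>
  proof (rule injective_on_if_det_nonzero[OF repS[OF that]])
    show "D = V.span (e (D, \<tau>) ` {..<n (D, \<tau>)})" using span[OF that] by simp
    show "Vector_Spaces.linear scale (*) (\<kappa> (D, \<tau>) k)" for k by (rule lin[OF that])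
    have "det (M (D, \<tau>) x) \<noteq> 0" using x(2) that finS by (simp add: f_def)
    then show "det (mat (n (D, \<tau>)) (n (D, \<tau>)) (\<lambda>(k, l). \<kappa> (D, \<tau>) k (\<tau> x (e (D, \<tau>) l)))) \<noteq> 0"
      by (simp add: M_def)
  qed
  then have "injective_on D (\<tau> x)" if "(D, \<tau>) \<in> R" for D \<tau>
    using minimal_family_injective[OF fam xA _ S(2) that] R(2)[OF that]
    by (simp add: irreducible_rep_def)
  then show ?thesis using R(4)[OF xA] x(1) by blast
qed

end

section \<open>The group algebra of a Galois group\<close>

locale galois =
  fixes \<iota> :: "'e::field \<Rightarrow> 'f::field" and G :: "('f \<Rightarrow> 'f) set"
  assumes galois_extension: "finite_galois_extension \<iota>" and G_eq: "G = galois_group \<iota>"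
begin

lemma emb: "field_embedding \<iota>"
  using galois_extension by (simp add: finite_galois_extension_def finite_extension_def)

sublocale EF: vector_space "ext_scale \<iota>"
  by (rule vector_space_ext_scale[OF emb])

lemma iota_zero: "\<iota> 0 = 0"
proof -
  have "\<iota> (0 + 0) = \<iota> 0 + \<iota> 0" using emb unfolding field_embedding_def by blast
  then have "\<iota> 0 = \<iota> 0 + \<iota> 0" by (simp only: add_0_left)
  then show ?thesis by (simp only: add_cancel_right_right)
qed

lemma iota_one: "\<iota> 1 = 1"
  using emb by (simp add: field_embedding_def)

lemma iota_diff: "\<iota> (x - y) = \<iota> x - \<iota> y"
proof -
  have "\<iota> (x - y + y) = \<iota> (x - y) + \<iota> y" using emb unfolding field_embedding_def by blast
  then show ?thesis by simp
qed

lemma iota_eq_0: "\<iota> c = 0 \<Longrightarrow> c = 0"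
  using field_embedding_inj[OF emb] iota_zero by (metis injD)

lemma fixed: "(\<And>\<sigma>. \<sigma> \<in> G \<Longrightarrow> \<sigma> x = x) \<Longrightarrow> x \<in> range \<iota>"
  using galois_extension by (auto simp: finite_galois_extension_def G_eq)

lemma G_add: "\<sigma> \<in> G \<Longrightarrow> \<sigma> (x + y) = \<sigma> x + \<sigma> y"
  and G_mult: "\<sigma> \<in> G \<Longrightarrow> \<sigma> (x * y) = \<sigma> x * \<sigma> y"
  and G_iota: "\<sigma> \<in> G \<Longrightarrow> \<sigma> (\<iota> c) = \<iota> c"
  and G_bij: "\<sigma> \<in> G \<Longrightarrow> bij \<sigma>"
  by (auto simp: G_eq galois_group_def)

lemma G_zero: "\<sigma> \<in> G \<Longrightarrow> \<sigma> 0 = 0"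
  using G_iota[of \<sigma> 0] iota_zero by simp

lemma G_one: "\<sigma> \<in> G \<Longrightarrow> \<sigma> 1 = 1"
  using G_iota[of \<sigma> 1] iota_one by simp

lemma G_sum: "\<sigma> \<in> G \<Longrightarrow> \<sigma> (\<Sum>i\<in>I. f i) = (\<Sum>i\<in>I. \<sigma> (f i))"
  by (induction I rule: infinite_finite_induct) (auto simp: G_add G_zero)

lemma id_G: "id \<in> G"
  by (auto simp: G_eq galois_group_def)

lemma comp_G: "\<sigma> \<in> G \<Longrightarrow> \<tau> \<in> G \<Longrightarrow> \<sigma> \<circ> \<tau> \<in> G"
  by (auto simp: G_eq galois_group_def bij_comp)

lemma inv_G:
  assumes "\<sigma> \<in> G"
  shows "inv_into UNIV \<sigma> \<in> G"
proof -
  have bij: "bij \<sigma>" using assms by (rule G_bij)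
  have l: "\<sigma> (inv_into UNIV \<sigma> x) = x" for x using bij by (simp add: bij_is_surj surj_f_inv_f)
  have inj: "x = y" if "\<sigma> x = \<sigma> y" for x y using bij that by (auto simp: bij_def inj_def)
  have "inv_into UNIV \<sigma> (x + y) = inv_into UNIV \<sigma> x + inv_into UNIV \<sigma> y" "inv_into UNIV \<sigma> (x * y) = inv_into UNIV \<sigma> x * inv_into UNIV \<sigma> y" "inv_into UNIV \<sigma> (\<iota> c) = \<iota> c" for x y c
    by (rule inj, simp add: l G_add[OF assms] G_mult[OF assms] G_iota[OF assms])+
  then show ?thesis using bij by (auto simp: G_eq galois_group_def bij_imp_bij_inv)
qed

lemma inv_comp_G: "\<sigma> \<in> G \<Longrightarrow> inv_into UNIV \<sigma> \<circ> \<sigma> = id" "\<sigma> \<in> G \<Longrightarrow> \<sigma> \<circ> inv_into UNIV \<sigma> = id"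
  using G_bij[of \<sigma>] by (auto simp: bij_def surj_iff inj_iff)

lemma G_scale: "\<sigma> \<in> G \<Longrightarrow> \<sigma> (ext_scale \<iota> c x) = \<iota> c * \<sigma> x"
  by (simp add: ext_scale_def G_mult G_iota)

text \<open>Automorphisms fix \<open>E\<close>, so a scalar leaves the relation as the common factor
  \<open>h (\<iota> a)\<close>, and the relation spreads from \<open>B\<close> to \<open>F\<close>,
  where Dedekind independence applies. The embedding \<open>h\<close> allows coefficients in
  \<open>F\<close> itself as well as in its algebraic closure.\<close>

lemma independent_on_spanning_set:
  fixes h :: "'f \<Rightarrow> 'k::field"
  assumes S: "finite S" "S \<subseteq> G" and B: "EF.span B = UNIV"
    and h: "\<And>x y. h (x + y) = h x + h y" "\<And>x y. h (x * y) = h x * h y" "h 1 = 1" "inj h"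
    and zero: "\<And>b. b \<in> B \<Longrightarrow> (\<Sum>\<sigma>\<in>S. c \<sigma> * h (\<sigma> b)) = 0" and \<sigma>: "\<sigma> \<in> S"
  shows "c \<sigma> = 0"
proof -
  have "h 0 = h 0 + h 0" using h(1)[of 0 0] by (simp only: add_0_left)
  then have h0: "h 0 = 0" by (simp only: add_cancel_right_right)
  have "(\<Sum>\<sigma>\<in>S. c \<sigma> * h (\<sigma> x)) = 0" for x
  proof -
    have "x \<in> EF.span B" using B by simp
    then show ?thesis
    proof (induction rule: EF.span_induct_alt)
      case base
      show ?case using S(2) by (intro sum.neutral) (auto simp: G_zero h0 subset_iff)
    next
      case (step a b y)
      have "c \<sigma> * h (\<sigma> (ext_scale \<iota> a b + y)) = h (\<iota> a) * (c \<sigma> * h (\<sigma> b)) + c \<sigma> * h (\<sigma> y)"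
        if "\<sigma> \<in> S" for \<sigma>
        using that S(2) by (auto simp: G_add G_scale h algebra_simps subset_iff)
      then have "(\<Sum>\<sigma>\<in>S. c \<sigma> * h (\<sigma> (ext_scale \<iota> a b + y))) =
          h (\<iota> a) * (\<Sum>\<sigma>\<in>S. c \<sigma> * h (\<sigma> b)) + (\<Sum>\<sigma>\<in>S. c \<sigma> * h (\<sigma> y))"
        by (simp add: sum.distrib sum_distrib_left)
      then show ?case using zero[OF step(1)] step(2) by simp
    qed
  qed
  moreover have "inj_on (\<lambda>\<sigma> x. h (\<sigma> x)) S"
    using h(4) by (auto simp: inj_on_def fun_eq_iff inj_def)
  ultimately show ?thesis
    using dedekind_independence[of S "\<lambda>\<sigma> x. h (\<sigma> x)" c \<sigma>] S \<sigma> by (auto simp: h G_mult G_one subset_iff)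
qed

text \<open>Artin's bound: more automorphisms than elements of a finite spanning set
  \<open>B\<close> would be linearly related after restriction to \<open>B\<close>, contrary to
  independence.\<close>

lemma finite_G: "finite G"
proof (rule ccontr)
  assume "infinite G"
  obtain B where B: "finite B" "EF.span B = UNIV"
    using galois_extension by (auto simp: finite_galois_extension_def finite_extension_def)
  obtain S where S: "finite S" "S \<subseteq> G" "card S = Suc (card B)"
    using infinite_arbitrarily_large[OF \<open>infinite G\<close>, of "Suc (card B)"] by blast
  interpret F: vector_space "fun_scale :: 'f \<Rightarrow> ('f \<Rightarrow> 'f) \<Rightarrow> 'f \<Rightarrow> 'f" by (rule vector_space_fun_scale)
  let ?v = "\<lambda>\<sigma> b. if b \<in> B then \<sigma> b else 0"
  have "card (unit_fun ` B :: ('f \<Rightarrow> 'f) set) < card S" 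
    using card_image_le[OF B(1), of "unit_fun :: 'f \<Rightarrow> 'f \<Rightarrow> 'f"] S(3) by simp
  moreover have "?v \<sigma> \<in> F.span (unit_fun ` B)" for \<sigma>
    using supported_on_subset_span[OF B(1)] by (auto simp: supported_on_def)
  ultimately obtain c where c: "\<exists>\<sigma>\<in>S. c \<sigma> \<noteq> 0" "(\<Sum>\<sigma>\<in>S. fun_scale (c \<sigma>) (?v \<sigma>)) = 0"
    by (rule F.nontrivial_relation[OF finite_imageI[OF B(1)] S(1)])
  have "(\<Sum>\<sigma>\<in>S. c \<sigma> * \<sigma> b) = 0" if "b \<in> B" for b
    using fun_cong[OF c(2), of b] that by (simp add: sum_fun_apply fun_scale_def)
  then have "c \<sigma> = 0" if "\<sigma> \<in> S" for \<sigma>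
    using independent_on_spanning_set[OF S(1,2) B(2), of "\<lambda>x. x" c \<sigma>] that by (simp add: inj_def)
  then show False using c(1) by blast
qed

section \<open>The group algebra and its regular representation\<close>

definition group_algebra :: "(('f \<Rightarrow> 'f) \<Rightarrow> 'k::field) set" where
  "group_algebra = supported_on G"

definition convolution :: "(('f \<Rightarrow> 'f) \<Rightarrow> 'k::field) \<Rightarrow> (('f \<Rightarrow> 'f) \<Rightarrow> 'k) \<Rightarrow> ('f \<Rightarrow> 'f) \<Rightarrow> 'k" where
  "convolution x y g = (if g \<in> G then \<Sum>h\<in>G. x h * y (inv_into UNIV h \<circ> g) else 0)"

text \<open>Right translation: with \<open>\<sigma> = \<tau> \<circ> h\<close> the value at \<tau>
  is the sum of \<open>x h * v (\<tau> \<circ> h)\<close>. The chosen form displays the matrix of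
  the action, whose entries become conjugates of \<alpha> when \<open>x\<close> records those
  conjugates.\<close>

definition regular_action :: "(('f \<Rightarrow> 'f) \<Rightarrow> 'k::field) \<Rightarrow> (('f \<Rightarrow> 'f) \<Rightarrow> 'k) \<Rightarrow> ('f \<Rightarrow> 'f) \<Rightarrow> 'k" where
  "regular_action x v \<tau> = (if \<tau> \<in> G then \<Sum>\<sigma>\<in>G. x (inv_into UNIV \<tau> \<circ> \<sigma>) * v \<sigma> else 0)"

lemma inv_comp_cancel: "\<sigma> \<in> G \<Longrightarrow> inv_into UNIV \<sigma> \<circ> (\<sigma> \<circ> h) = h" "\<sigma> \<in> G \<Longrightarrow> \<sigma> \<circ> (inv_into UNIV \<sigma> \<circ> h) = h"
  by (simp_all add: comp_assoc[symmetric] inv_comp_G)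

lemma inv_comp_distrib: "\<sigma> \<in> G \<Longrightarrow> \<tau> \<in> G \<Longrightarrow> inv_into UNIV (\<sigma> \<circ> \<tau>) = inv_into UNIV \<tau> \<circ> inv_into UNIV \<sigma>"
  by (rule o_inv_distrib) (auto intro: G_bij)

lemma algebra_action_group_algebra:
  "algebra_action fun_scale fun_scale (group_algebra :: (('f \<Rightarrow> 'f) \<Rightarrow> 'k::alg_closed_field) set)
     convolution (unit_fun id)"
proof (intro algebra_action.intro algebra_action_axioms.intro vector_space_fun_scale)
  show "module.subspace fun_scale (group_algebra :: (('f \<Rightarrow> 'f) \<Rightarrow> 'k) set)"
    unfolding group_algebra_def by (rule subspace_supported_on)
qed (use id_G in \<open>auto simp: group_algebra_def supported_on_def convolution_def unit_fun_def\<close>)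

lemma linear_regular_action:
  "Vector_Spaces.linear fun_scale fun_scale (regular_action x)"
  "Vector_Spaces.linear fun_scale fun_scale (\<lambda>x. regular_action x v)"
  by (auto simp: Vector_Spaces.linear_iff vector_space_fun_scale fun_eq_iff regular_action_def
      fun_scale_def distrib_left distrib_right sum.distrib sum_distrib_left ac_simps)

lemma rep_regular_action:
  "algebra_action.rep fun_scale fun_scale (group_algebra :: (('f \<Rightarrow> 'f) \<Rightarrow> 'k::alg_closed_field) set)
     convolution (unit_fun id) group_algebra regular_action"
proof -
  interpret algebra_action fun_scale fun_scale "group_algebra :: (('f \<Rightarrow> 'f) \<Rightarrow> 'k) set" convolution "unit_fun id"
    by (rule algebra_action_group_algebra)
  have mul: "regular_action (convolution x y) v = regular_action x (regular_action y v)"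
    for x y v :: "('f \<Rightarrow> 'f) \<Rightarrow> 'k"
  proof
    fix \<tau>
    show "regular_action (convolution x y) v \<tau> = regular_action x (regular_action y v) \<tau>"
    proof (cases "\<tau> \<in> G")
      case \<tau>: True
      have "regular_action (convolution x y) v \<tau> =
          (\<Sum>\<sigma>\<in>G. \<Sum>h\<in>G. x h * y (inv_into UNIV h \<circ> (inv_into UNIV \<tau> \<circ> \<sigma>)) * v \<sigma>)"
        using \<tau> by (simp add: regular_action_def convolution_def inv_G comp_G sum_distrib_right)
      also have "\<dots> = (\<Sum>h\<in>G. x h * (\<Sum>\<sigma>\<in>G. y (inv_into UNIV h \<circ> (inv_into UNIV \<tau> \<circ> \<sigma>)) * v \<sigma>))"
        by (subst sum.swap) (simp add: sum_distrib_left mult.assoc)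
      \<comment> \<open>The substitution is \<open>\<rho> = \<tau> \<circ> h\<close>, whose inverse
        is that of \<open>h\<close> after that of \<tau>.\<close>
      also have "\<dots> = (\<Sum>\<rho>\<in>G. x (inv_into UNIV \<tau> \<circ> \<rho>) * (\<Sum>\<sigma>\<in>G. y (inv_into UNIV \<rho> \<circ> \<sigma>) * v \<sigma>))"
        by (rule sum.reindex_bij_witness[of _ "\<lambda>\<rho>. inv_into UNIV \<tau> \<circ> \<rho>" "\<lambda>h. \<tau> \<circ> h"])
          (use \<tau> in \<open>auto simp: inv_comp_cancel inv_comp_distrib comp_G inv_G comp_assoc\<close>)
      also have "\<dots> = regular_action x (regular_action y v) \<tau>"
        using \<tau> by (simp add: regular_action_def)
      finally show ?thesis .
    qed (simp add: regular_action_def)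
  qed
  have one: "regular_action (unit_fun id) v = v" if v: "v \<in> group_algebra" for v :: "('f \<Rightarrow> 'f) \<Rightarrow> 'k"
  proof
    fix \<tau>
    show "regular_action (unit_fun id) v \<tau> = v \<tau>"
    proof (cases "\<tau> \<in> G")
      case \<tau>: True
      have "unit_fun id (inv_into UNIV \<tau> \<circ> \<sigma>) * v \<sigma> = (if \<tau> = \<sigma> then v \<sigma> else 0)" for \<sigma>
      proof -
        have "inv_into UNIV \<tau> \<circ> \<sigma> = id \<longleftrightarrow> \<tau> = \<sigma>"
          using inv_comp_cancel(2)[OF \<tau>, of \<sigma>] inv_comp_G[OF \<tau>] by auto
        then show ?thesis by (simp add: unit_fun_def)
      qed
      then show ?thesis using \<tau> finite_G by (simp add: regular_action_def)
    next
      case False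
      then show ?thesis using v by (simp add: regular_action_def group_algebra_def supported_on_def)
    qed
  qed
  have closed: "regular_action x v \<in> group_algebra" for x v :: "('f \<Rightarrow> 'f) \<Rightarrow> 'k"
    by (simp add: regular_action_def group_algebra_def supported_on_def)
  show ?thesis unfolding rep_def
    using linear_regular_action mul one closed subspace_A by blast
qed

section \<open>Normal bases from nonsingular matrices of conjugates\<close>

text \<open>Invertibility over \<open>F\<close> of the square matrix with entries
  \<open>\<pi> (\<sigma> \<alpha>)\<close>, put as a trivial kernel to avoid ordering
  \<open>G\<close>.\<close>

definition nonsingular_conjugates :: "'f \<Rightarrow> bool" where
  "nonsingular_conjugates \<alpha> \<longleftrightarrow>
     (\<forall>v. (\<forall>\<pi>\<in>G. (\<Sum>\<sigma>\<in>G. \<pi> (\<sigma> \<alpha>) * v \<sigma>) = 0) \<longrightarrow> (\<forall>\<sigma>\<in>G. v \<sigma> = 0))"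

text \<open>Scalars are extended to the algebraic closure, where eigenvalues exist; nonsingularity
  descends because a kernel vector over \<open>F\<close> remains one over the closure.\<close>

lemma exists_nonsingular_conjugates:
  assumes H: "is_additive_subgroup H" and span: "EF.span H = UNIV"
  shows "\<exists>\<alpha>\<in>H. nonsingular_conjugates \<alpha>"
proof -
  interpret algebra_action fun_scale fun_scale "group_algebra :: (('f \<Rightarrow> 'f) \<Rightarrow> 'f alg_closure) set"
      convolution "unit_fun id"
    by (rule algebra_action_group_algebra)
  have pair: "vector_space_pair fun_scale ((*) :: 'f alg_closure \<Rightarrow> _)"
    by (intro vector_space_pair.intro vector_space_field vector_space_fun_scale)
  define \<phi> :: "'f \<Rightarrow> ('f \<Rightarrow> 'f) \<Rightarrow> 'f alg_closure" where "\<phi> \<alpha> g = (if g \<in> G then to_ac (g \<alpha>) else 0)" for \<alpha> g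
  have "\<exists>x\<in>\<phi> ` H. injective_on group_algebra (regular_action x)"
  proof (rule exists_injective_element[OF _ _ _ _ rep_regular_action])
    show "\<phi> ` H \<subseteq> group_algebra" by (auto simp: \<phi>_def group_algebra_def supported_on_def)
    have "\<phi> 0 = 0" by (auto simp: \<phi>_def G_zero)
    then show "0 \<in> \<phi> ` H" using H by (metis imageI is_additive_subgroup_def)
    have "\<phi> a + \<phi> b = \<phi> (a + b)" for a b by (auto simp: \<phi>_def G_add)
    then show "x + y \<in> \<phi> ` H" if "x \<in> \<phi> ` H" "y \<in> \<phi> ` H" for x y
      using that H by (auto simp: is_additive_subgroup_def)
    show "l x = 0" if l: "Vector_Spaces.linear fun_scale (*) l" and van: "\<And>y. y \<in> \<phi> ` H \<Longrightarrow> l y = 0"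
      and x: "x \<in> group_algebra" for l and x :: "('f \<Rightarrow> 'f) \<Rightarrow> 'f alg_closure"
    proof -
      \<comment> \<open>A functional on the group algebra is given by its values on unit functions,
        so its vanishing on \<open>\<phi> b\<close> is a relation between the conjugates of
        \<open>b\<close>, to be refuted by independence on the spanning set
        \<open>H\<close>.\<close>
      have l_eq: "l y = (\<Sum>g\<in>G. l (unit_fun g) * y g)" if "y \<in> group_algebra" for y
      proof -
        have "l y = l (\<Sum>g\<in>G. fun_scale (y g) (unit_fun g))"
          using that unfolding group_algebra_def by (intro arg_cong[of _ _ l] supported_on_eq_sum finite_G)
        then show ?thesis
          by (simp add: vector_space_pair.linear_sum[OF pair l] vector_space_pair.linear_scale[OF pair l] mult.commute)
      qed
      have "(\<Sum>g\<in>G. l (unit_fun g) * to_ac (g b)) = 0" if "b \<in> H" for b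
      proof -
        have "\<phi> b \<in> group_algebra" by (auto simp: \<phi>_def group_algebra_def supported_on_def)
        from l_eq[OF this] van[of "\<phi> b"] that show ?thesis by (simp add: \<phi>_def)
      qed
      then have "l (unit_fun g) = 0" if "g \<in> G" for g
        using independent_on_spanning_set[OF finite_G subset_refl span, of to_ac "\<lambda>g. l (unit_fun g)" g] that
        by (simp add: inj_to_ac)
      then show ?thesis using l_eq[OF x] by simp
    qed
    show "finite (unit_fun ` G)" using finite_G by simp
    show "group_algebra \<subseteq> V.span (unit_fun ` G)"
      unfolding group_algebra_def by (rule supported_on_subset_span[OF finite_G])
  qed
  then obtain \<alpha> where \<alpha>: "\<alpha> \<in> H" "injective_on group_algebra (regular_action (\<phi> \<alpha>))" by blast
  have "nonsingular_conjugates \<alpha>"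
    unfolding nonsingular_conjugates_def
  proof (intro allI impI ballI)
    fix v \<sigma> assume v: "\<forall>\<pi>\<in>G. (\<Sum>\<sigma>\<in>G. \<pi> (\<sigma> \<alpha>) * v \<sigma>) = 0" and \<sigma>: "\<sigma> \<in> G"
    define w where "w \<sigma> = (if \<sigma> \<in> G then to_ac (v \<sigma>) else 0)" for \<sigma>
    have "regular_action (\<phi> \<alpha>) w = 0"
    proof
      fix \<tau>
      \<comment> \<open>The row \<tau> of the regular action is the row \<pi> of the given system
        with \<pi> the inverse of \<tau>.\<close>
      have "(\<Sum>\<sigma>\<in>G. \<phi> \<alpha> (inv_into UNIV \<tau> \<circ> \<sigma>) * w \<sigma>) = to_ac (\<Sum>\<sigma>\<in>G. inv_into UNIV \<tau> (\<sigma> \<alpha>) * v \<sigma>)" if "\<tau> \<in> G"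
        unfolding to_ac_sum using that by (intro sum.cong) (auto simp: \<phi>_def w_def comp_G inv_G)
      then show "regular_action (\<phi> \<alpha>) w \<tau> = 0 \<tau>"
        using v inv_G[of \<tau>] by (simp add: regular_action_def)
    qed
    moreover have "w \<in> group_algebra" by (auto simp: w_def group_algebra_def supported_on_def)
    ultimately have "w = 0" using \<alpha>(2) unfolding injective_on_def by blast
    then have "w \<sigma> = 0" by simp
    then have "to_ac (v \<sigma>) = 0" unfolding w_def using \<sigma> by (simp only: if_True)
    then show "v \<sigma> = 0" by (simp only: to_ac_eq_0_iff)
  qed
  then show ?thesis using \<alpha>(1) by blast
qed

text \<open>Applying \<open>G\<close> to a relation over \<open>E\<close> yields a kernel vector,
  whence independence. For spanning, the linear system with the conjugates of \<beta> on its
  right-hand side is solvable over \<open>F\<close> by counting; its unique solution is fixed by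
  \<open>G\<close>, so lies in \<open>E\<close>, and the row of the identity expresses
  \<beta>.\<close>

lemma basis_of_nonsingular:
  assumes "nonsingular_conjugates \<alpha>"
  shows "is_basis_family \<iota> G (\<lambda>\<sigma>. \<sigma> \<alpha>)"
proof -
  have ns: "v \<sigma> = 0" if "\<forall>\<pi>\<in>G. (\<Sum>\<sigma>\<in>G. \<pi> (\<sigma> \<alpha>) * v \<sigma>) = 0" "\<sigma> \<in> G" for v \<sigma>
    using assms that unfolding nonsingular_conjugates_def by blast
  have indep: "c \<sigma> = 0" if c: "(\<Sum>\<sigma>\<in>G. \<iota> (c \<sigma>) * \<sigma> \<alpha>) = 0" and \<sigma>: "\<sigma> \<in> G" for c \<sigma>
  proof -
    have "(\<Sum>\<sigma>\<in>G. \<pi> (\<sigma> \<alpha>) * \<iota> (c \<sigma>)) = 0" if \<pi>: "\<pi> \<in> G" for \<pi>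
    proof -
      have "(\<Sum>\<sigma>\<in>G. \<pi> (\<sigma> \<alpha>) * \<iota> (c \<sigma>)) = \<pi> (\<Sum>\<sigma>\<in>G. \<iota> (c \<sigma>) * \<sigma> \<alpha>)"
        by (simp add: G_sum[OF \<pi>] G_mult[OF \<pi>] G_iota[OF \<pi>] mult.commute)
      then show ?thesis using c G_zero[OF \<pi>] by simp
    qed
    from ns[of "\<lambda>\<sigma>. \<iota> (c \<sigma>)", OF ballI[OF this] \<sigma>] show ?thesis by (rule iota_eq_0)
  qed
  have inj: "inj_on (\<lambda>\<sigma>. \<sigma> \<alpha>) G"
  proof (rule inj_onI, rule ccontr)
    fix \<sigma> \<tau> assume st: "\<sigma> \<in> G" "\<tau> \<in> G" "\<sigma> \<alpha> = \<tau> \<alpha>" "\<sigma> \<noteq> \<tau>"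
    \<comment> \<open>Two equal conjugates would satisfy the relation with coefficients 1 and
      -1.\<close>
    define c :: "('f \<Rightarrow> 'f) \<Rightarrow> 'e" where "c \<rho> = (if \<rho> = \<sigma> then 1 else if \<rho> = \<tau> then -1 else 0)" for \<rho>
    have "(\<Sum>\<rho>\<in>G. \<iota> (c \<rho>) * \<rho> \<alpha>) = (\<Sum>\<rho>\<in>{\<sigma>, \<tau>}. \<iota> (c \<rho>) * \<rho> \<alpha>)"
      using st finite_G by (intro sum.mono_neutral_right) (auto simp: c_def iota_zero)
    also have "\<dots> = 0" using st iota_diff[of 0 1] by (simp add: c_def iota_zero iota_one)
    finally show False using indep[of c \<sigma>] st by (simp add: c_def)
  qed
  have "EF.independent ((\<lambda>\<sigma>. \<sigma> \<alpha>) ` G)"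
  proof (rule EF.independent_if_scalars_zero)
    fix d x assume d: "(\<Sum>x\<in>(\<lambda>\<sigma>. \<sigma> \<alpha>) ` G. ext_scale \<iota> (d x) x) = 0" and "x \<in> (\<lambda>\<sigma>. \<sigma> \<alpha>) ` G"
    then obtain \<sigma> where \<sigma>: "\<sigma> \<in> G" "x = \<sigma> \<alpha>" by blast
    have "(\<Sum>\<sigma>\<in>G. \<iota> (d (\<sigma> \<alpha>)) * \<sigma> \<alpha>) = 0"
      using d by (simp add: sum.reindex[OF inj] ext_scale_def)
    from indep[OF this \<sigma>(1)] show "d x = 0" using \<sigma>(2) by simp
  qed (use finite_G in simp)
  moreover have "\<beta> \<in> EF.span ((\<lambda>\<sigma>. \<sigma> \<alpha>) ` G)" for \<beta>
  proof -
    interpret F: vector_space "fun_scale :: 'f \<Rightarrow> (('f \<Rightarrow> 'f) \<Rightarrow> 'f) \<Rightarrow> ('f \<Rightarrow> 'f) \<Rightarrow> 'f"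
      by (rule vector_space_fun_scale)
    \<comment> \<open>\<open>None\<close> carries the right-hand side and
      \<open>Some \<sigma>\<close> the column of \<sigma>: one vector more than the dimension, hence
      a relation. Nonsingularity makes its coefficient at \<open>None\<close> nonzero, so it can be
      solved for \<beta> and its conjugates.\<close>
    define u where "u i \<pi> = (if \<pi> \<in> G then case i of None \<Rightarrow> \<pi> \<beta> | Some \<sigma> \<Rightarrow> \<pi> (\<sigma> \<alpha>) else 0)"
      for i and \<pi> :: "'f \<Rightarrow> 'f"
    let ?I = "insert None (Some ` G)"
    have finI: "finite ?I" using finite_G by simp
    have "card (unit_fun ` G :: (('f \<Rightarrow> 'f) \<Rightarrow> 'f) set) < card ?I"
      using card_image_le[OF finite_G, of "unit_fun :: ('f \<Rightarrow> 'f) \<Rightarrow> _ \<Rightarrow> 'f"] finite_G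
      by (simp add: card_insert_if card_image)
    moreover have "u i \<in> F.span (unit_fun ` G)" for i
      using supported_on_subset_span[OF finite_G] by (auto simp: supported_on_def u_def)
    ultimately obtain c where c: "\<exists>i\<in>?I. c i \<noteq> 0" "(\<Sum>i\<in>?I. fun_scale (c i) (u i)) = 0"
      by (rule F.nontrivial_relation[OF finite_imageI[OF finite_G] finI])
    have rel: "c None * \<pi> \<beta> + (\<Sum>\<sigma>\<in>G. \<pi> (\<sigma> \<alpha>) * c (Some \<sigma>)) = 0" if "\<pi> \<in> G" for \<pi>
    proof -
      have "(\<Sum>i\<in>?I. c i * u i \<pi>) = 0"
        using fun_cong[OF c(2), of \<pi>] by (simp only: sum_fun_apply fun_scale_def zero_fun_apply)
      then show ?thesis
        using that finite_G by (simp add: sum.insert sum.reindex u_def mult.commute)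
    qed
    have c0: "c None \<noteq> 0"
    proof
      assume "c None = 0"
      then have "c (Some \<sigma>) = 0" if "\<sigma> \<in> G" for \<sigma>
        using ns[of "\<lambda>\<sigma>. c (Some \<sigma>)" \<sigma>] rel that by simp
      then show False using c(1) \<open>c None = 0\<close> by blast
    qed
    define v where "v \<sigma> = - c (Some \<sigma>) / c None" for \<sigma>
    have v: "(\<Sum>\<sigma>\<in>G. \<pi> (\<sigma> \<alpha>) * v \<sigma>) = \<pi> \<beta>" if "\<pi> \<in> G" for \<pi>
    proof -
      have "(\<Sum>\<sigma>\<in>G. \<pi> (\<sigma> \<alpha>) * v \<sigma>) = - (\<Sum>\<sigma>\<in>G. \<pi> (\<sigma> \<alpha>) * c (Some \<sigma>)) / c None"
        by (simp add: v_def sum_negf sum_divide_distrib)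
      also have "- (\<Sum>\<sigma>\<in>G. \<pi> (\<sigma> \<alpha>) * c (Some \<sigma>)) = c None * \<pi> \<beta>"
        using rel[OF that] by (metis eq_neg_iff_add_eq_0)
      finally show ?thesis using c0 by simp
    qed
    have "v \<sigma> \<in> range \<iota>" if \<sigma>: "\<sigma> \<in> G" for \<sigma>
    proof (rule fixed)
      fix \<rho> assume \<rho>: "\<rho> \<in> G"
      \<comment> \<open>Applying \<rho> to the equation whose row is the inverse of \<rho> after
        \<pi> shows that the family \<open>\<rho> (v \<sigma>)\<close> solves the same system;
        uniqueness then makes \<open>v \<sigma>\<close> fixed.\<close>
      have "(\<Sum>\<sigma>\<in>G. \<pi> (\<sigma> \<alpha>) * (\<rho> (v \<sigma>) - v \<sigma>)) = 0" if \<pi>: "\<pi> \<in> G" for \<pi>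
      proof -
        have \<pi>': "inv_into UNIV \<rho> \<circ> \<pi> \<in> G" using \<rho> \<pi> by (intro comp_G inv_G)
        have cancel: "\<rho> (inv_into UNIV \<rho> x) = x" for x
          using inv_comp_G(2)[OF \<rho>] by (simp add: fun_eq_iff)
        have "\<rho> (\<Sum>\<sigma>\<in>G. (inv_into UNIV \<rho> \<circ> \<pi>) (\<sigma> \<alpha>) * v \<sigma>) = \<rho> ((inv_into UNIV \<rho> \<circ> \<pi>) \<beta>)"
          using v[OF \<pi>'] by simp
        then have "(\<Sum>\<sigma>\<in>G. \<pi> (\<sigma> \<alpha>) * \<rho> (v \<sigma>)) = \<pi> \<beta>"
          by (simp add: G_sum[OF \<rho>] G_mult[OF \<rho>] cancel)
        then show ?thesis using v[OF \<pi>] by (simp add: right_diff_distrib sum_subtractf)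
      qed
      from ns[of "\<lambda>\<sigma>. \<rho> (v \<sigma>) - v \<sigma>", OF ballI[OF this] \<sigma>] show "\<rho> (v \<sigma>) = v \<sigma>" by simp
    qed
    then have "\<forall>\<sigma>\<in>G. \<exists>d. v \<sigma> = \<iota> d" by blast
    then obtain d where d: "\<And>\<sigma>. \<sigma> \<in> G \<Longrightarrow> v \<sigma> = \<iota> (d \<sigma>)" by metis
    have "\<beta> = (\<Sum>\<sigma>\<in>G. ext_scale \<iota> (d \<sigma>) (\<sigma> \<alpha>))"
      using v[OF id_G] d by (simp add: ext_scale_def mult.commute)
    also have "\<dots> \<in> EF.span ((\<lambda>\<sigma>. \<sigma> \<alpha>) ` G)"
      by (intro EF.span_sum EF.span_scale EF.span_base) auto
    finally show ?thesis .
  qed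
  ultimately show ?thesis using inj unfolding is_basis_family_def by blast
qed

end

theorem mainTheorem2:
  fixes \<iota> :: "'e::field \<Rightarrow> 'f::field" and H :: "'f set"
  assumes "finite_galois_extension \<iota>"
    and "is_additive_subgroup H"
    and "ext_span \<iota> H = UNIV"
  shows "\<exists>\<alpha>\<in>H. is_basis_family \<iota> (galois_group \<iota>) (\<lambda>\<sigma>. \<sigma> \<alpha>)"
proof -
  interpret galois \<iota> "galois_group \<iota>"
    using assms(1) by unfold_locales simp_all
  show ?thesis
    using exists_nonsingular_conjugates[OF assms(2,3)] basis_of_nonsingular by blast
qed

end
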